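(* Let $(R,\mathfrak{m},K)$ be a local Artinian commutative ring, let $n\ge1$, and let $C\subseteq R^n$ be a nonzero $R$-code. Then $C$ is MDS if and only if $C$ is a free $R$-module and is MDT.
   Context: All rings are commutative with unity. $(R,\mathfrak{m},K)$ is a local Artinian ring with maximal ideal $\mathfrak{m}$ and residue field $K=R/\mathfrak{m}$. An $R$-code of length $n$ is an $R$-submodule $C\subseteq R^n$. $\lambda(M)$ denotes the length of an $R$-module $M$. The socle of a finitely generated $R$-module $M$ is $\operatorname{soc}(M)=\{v\in M : \mathfrak{m}v=0\}$, and $\operatorname{type}(M)=\dim_K\operatorname{soc}(M)$. For $C\ne 0$, $d_H(C)=\min\{w_H(v) : v\in C\setminus\{0\}\}$, where $w_H(v)=|\{i : v_i\neq 0\}|$. A nonzero code $C\subseteq R^n$ is MDS (maximum distance separable) if $d_H(C)= n-\frac{\lambda(C)}{\lambda(R)}+1$, and MDT (maximum distance type) if $d_H(C)= n-\frac{\operatorname{type}(C)}{\operatorname{type}(R)}+1$. *)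

theory Defs
  imports
    "HOL-Algebra.QuotRing"
    "HOL-Library.Extended_Nat"
    "Jordan_Normal_Form.Missing_VectorSpace"
begin

section \<open>Local Artinian rings\<close>

locale artinian_cring = cring R for R (structure) +
  assumes descending_chain_condition:
    "\<And>I :: nat \<Rightarrow> 'a set. \<lbrakk>\<And>k. ideal (I k) R; \<And>k. I (Suc k) \<subseteq> I k\<rbrakk>
       \<Longrightarrow> \<exists>N. \<forall>k\<ge>N. I k = I N"

locale local_cring = cring R for R (structure) +
  fixes \<mm> :: "'a set"
  assumes maximal: "maximalideal \<mm> R"
    and maximal_unique: "\<And>I. maximalideal I R \<Longrightarrow> I = \<mm>"

locale local_artinian_ring = local_cring + artinian_cring

section \<open>Free modules, length, socle and type\<close>

text \<open>The ring \<open>R\<close>, regarded as a module over itself.\<close>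

definition self_module :: "('a, 'r) ring_scheme \<Rightarrow> ('a, 'a) module" where
  "self_module R = \<lparr>carrier = carrier R, mult = mult R, one = one R,
                    zero = zero R, add = add R, smult = mult R\<rparr>"

definition free_module :: "('a, 'r) ring_scheme \<Rightarrow> ('a, 'b, 'c) module_scheme \<Rightarrow> bool" where
  "free_module R M \<longleftrightarrow>
     (\<exists>B \<subseteq> carrier M. \<not> module.lin_dep R M B \<and> module.span R M B = carrier M)"

text \<open>The length is the supremum of the lengths of all strict chains of submodules
  \<open>N 0 \<subset> N 1 \<subset> \<dots> \<subset> N k\<close>; it may be infinite.\<close>

definition module_length :: "('a, 'r) ring_scheme \<Rightarrow> ('a, 'b, 'c) module_scheme \<Rightarrow> enat" where
  "module_length R M =
     Sup {enat k | k. \<exists>N :: nat \<Rightarrow> 'b set.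
            (\<forall>i\<le>k. submodule R (N i) M) \<and> (\<forall>i<k. N i \<subset> N (Suc i))}"

definition socle :: "('a, 'r) ring_scheme \<Rightarrow> 'a set \<Rightarrow> ('a, 'b, 'c) module_scheme \<Rightarrow> 'b set" where
  "socle R \<mm> M = {v \<in> carrier M. \<forall>a\<in>\<mm>. a \<odot>\<^bsub>M\<^esub> v = \<zero>\<^bsub>M\<^esub>}"

text \<open>The socle as a module over the residue field \<open>R Quot \<mm>\<close>, whose elements are the cosets
  of \<open>\<mm>\<close>. All elements of a coset act in the same way on an element of the socle, so that the set
  below is a singleton (see \<open>coset_smult\<close> and
  \<open>socle_space_vectorspace\<close>).\<close>

definition socle_space ::
    "('a, 'r) ring_scheme \<Rightarrow> 'a set \<Rightarrow> ('a, 'b, 'c) module_scheme \<Rightarrow> ('a set, 'b) module" where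
  "socle_space R \<mm> M =
     \<lparr>carrier = socle R \<mm> M, mult = mult M, one = one M, zero = zero M, add = add M,
      smult = (\<lambda>X v. the_elem ((\<lambda>r. r \<odot>\<^bsub>M\<^esub> v) ` X))\<rparr>"

definition module_type :: "('a, 'r) ring_scheme \<Rightarrow> 'a set \<Rightarrow> ('a, 'b, 'c) module_scheme \<Rightarrow> nat" where
  "module_type R \<mm> M = vectorspace.dim (R Quot \<mm>) (socle_space R \<mm> M)"

lemma (in module) coset_smult:
  assumes I: "ideal \<mm> R" and r: "r \<in> carrier R" and v: "v \<in> socle R \<mm> M"
  shows "(\<mm> +>\<^bsub>R\<^esub> r) \<odot>\<^bsub>socle_space R \<mm> M\<^esub> v = r \<odot>\<^bsub>M\<^esub> v"
proof -
  interpret I: ideal \<mm> R by fact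
  have "(a \<oplus>\<^bsub>R\<^esub> r) \<odot>\<^bsub>M\<^esub> v = r \<odot>\<^bsub>M\<^esub> v" if "a \<in> \<mm>" for a
    using that r v I.Icarr[OF that] by (simp add: socle_def smult_l_distr)
  moreover have "\<exists>a. a \<in> \<mm>"
    using additive_subgroup.zero_closed[OF I.is_additive_subgroup] by blast
  ultimately have "(\<lambda>s. s \<odot>\<^bsub>M\<^esub> v) ` (\<mm> +>\<^bsub>R\<^esub> r) = {r \<odot>\<^bsub>M\<^esub> v}"
    by (auto simp: a_r_coset_def' image_iff)
  then show ?thesis by (simp add: socle_space_def)
qed

lemma (in module) socle_space_vectorspace:
  assumes m: "maximalideal \<mm> R"
  shows "vectorspace (R Quot \<mm>) (socle_space R \<mm> M)"
proof -
  interpret I: maximalideal \<mm> R by fact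
  have id: "ideal \<mm> R" by (rule I.is_ideal)
  have f: "field (R Quot \<mm>)" using I.quotient_is_field R.is_cring by blast
  note cs = coset_smult[OF id]
  have sub: "Module.submodule (socle R \<mm> M) R M"
    apply (rule submoduleI) unfolding socle_def
    apply (auto simp: smult_r_minus smult_r_distr I.Icarr)
    by (metis I.Icarr R.m_comm smult_assoc1 smult_r_null)
  have sm: "module R (M\<lparr>carrier := socle R \<mm> M\<rparr>)"
    using Module.submodule.submodule_is_module[OF sub] module_axioms by blast
  have ag: "abelian_group (socle_space R \<mm> M)"
    using module.axioms(2)[OF sm]
    by (auto simp: socle_space_def abelian_group_def abelian_monoid_def abelian_group_axioms_def comm_group_def comm_monoid_def
      group_def monoid_def comm_monoid_axioms_def group_axioms_def Units_def)
  have [simp]: "carrier (socle_space R \<mm> M) = socle R \<mm> M" "add (socle_space R \<mm> M) = add M"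
    by (auto simp: socle_space_def)
  have cl: "r \<in> carrier R \<Longrightarrow> v \<in> socle R \<mm> M \<Longrightarrow> r \<odot>\<^bsub>M\<^esub> v \<in> socle R \<mm> M" for r v
    using Module.submodule.smult_closed[OF sub] .
  have cl2: "w \<in> socle R \<mm> M \<Longrightarrow> v \<in> socle R \<mm> M \<Longrightarrow> w \<oplus>\<^bsub>M\<^esub> v \<in> socle R \<mm> M" for w v
    using submoduleE(5)[OF sub] .
  have sc: "v \<in> socle R \<mm> M \<Longrightarrow> v \<in> carrier M" for v by (simp add: socle_def)
  have car: "x \<in> carrier (R Quot \<mm>) \<Longrightarrow> \<exists>r\<in>carrier R. x = \<mm> +>\<^bsub>R\<^esub> r" for x
    by (auto simp: FactRing_def A_RCOSETS_def')
  have pl: "a \<in> carrier R \<Longrightarrow> b \<in> carrier R \<Longrightarrow> (\<mm> +>\<^bsub>R\<^esub> a) \<oplus>\<^bsub>R Quot \<mm>\<^esub> (\<mm> +>\<^bsub>R\<^esub> b) = \<mm> +>\<^bsub>R\<^esub> (a \<oplus>\<^bsub>R\<^esub> b)" for a b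
    by (simp add: FactRing_def I.a_rcos_sum)
  have ml: "a \<in> carrier R \<Longrightarrow> b \<in> carrier R \<Longrightarrow> (\<mm> +>\<^bsub>R\<^esub> a) \<otimes>\<^bsub>R Quot \<mm>\<^esub> (\<mm> +>\<^bsub>R\<^esub> b) = \<mm> +>\<^bsub>R\<^esub> (a \<otimes>\<^bsub>R\<^esub> b)" for a b
    by (simp add: FactRing_def I.rcoset_mult_add)
  have on: "\<one>\<^bsub>R Quot \<mm>\<^esub> = \<mm> +>\<^bsub>R\<^esub> \<one>\<^bsub>R\<^esub>" by (simp add: FactRing_def)
  have "module (R Quot \<mm>) (socle_space R \<mm> M)"
    apply (rule moduleI)
    subgoal using f field.is_ring fieldE(1) by blast
    subgoal by (rule ag)
    by (auto dest!: car simp: cs cl cl2 sc pl ml on smult_l_distr smult_r_distr smult_assoc1)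
  then show ?thesis using f by (simp add: vectorspace_def)
qed

section \<open>Codes\<close>

text \<open>The ambient module of codes of length \<open>n\<close>: functions on \<open>{..<n}\<close> with values in \<open>R\<close>.\<close>

abbreviation Rn :: "('a, 'r) ring_scheme \<Rightarrow> nat \<Rightarrow> ('a, nat \<Rightarrow> 'a) module" where
  "Rn R n \<equiv> ring.func_space R {..<n}"

definition is_code :: "('a, 'r) ring_scheme \<Rightarrow> nat \<Rightarrow> (nat \<Rightarrow> 'a) set \<Rightarrow> bool" where
  "is_code R n C \<longleftrightarrow> submodule R C (Rn R n)"

abbreviation code_as_module ::
    "('a, 'r) ring_scheme \<Rightarrow> nat \<Rightarrow> (nat \<Rightarrow> 'a) set \<Rightarrow> ('a, nat \<Rightarrow> 'a) module" where
  "code_as_module R n C \<equiv> (Rn R n)\<lparr>carrier := C\<rparr>"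

definition hamming_weight :: "('a, 'r) ring_scheme \<Rightarrow> nat \<Rightarrow> (nat \<Rightarrow> 'a) \<Rightarrow> nat" where
  "hamming_weight R n v = card {i \<in> {..<n}. v i \<noteq> \<zero>\<^bsub>R\<^esub>}"

definition min_distance :: "('a, 'r) ring_scheme \<Rightarrow> nat \<Rightarrow> (nat \<Rightarrow> 'a) set \<Rightarrow> nat" where
  "min_distance R n C = Min (hamming_weight R n ` (C - {\<zero>\<^bsub>Rn R n\<^esub>}))"

text \<open>Over an Artinian ring the two lengths below are finite, so that \<open>the_enat\<close> merely
  converts them to natural numbers.\<close>

definition MDS :: "('a, 'r) ring_scheme \<Rightarrow> nat \<Rightarrow> (nat \<Rightarrow> 'a) set \<Rightarrow> bool" where
  "MDS R n C \<longleftrightarrow>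
     C \<noteq> {\<zero>\<^bsub>Rn R n\<^esub>} \<and>
     real (min_distance R n C) =
       real n - real (the_enat (module_length R (code_as_module R n C)))
                / real (the_enat (module_length R (self_module R))) + 1"

definition MDT :: "('a, 'r) ring_scheme \<Rightarrow> 'a set \<Rightarrow> nat \<Rightarrow> (nat \<Rightarrow> 'a) set \<Rightarrow> bool" where
  "MDT R \<mm> n C \<longleftrightarrow>
     C \<noteq> {\<zero>\<^bsub>Rn R n\<^esub>} \<and>
     real (min_distance R n C) =
       real n - real (module_type R \<mm> (code_as_module R n C))
                / real (module_type R \<mm> (self_module R)) + 1"

end

theory Submission
  imports Defs
begin

text \<open>
  Write \<open>\<lambda>\<close> for the length, \<open>d\<close> for the minimum distance of \<open>C\<close> and \<open>k = n + 1 - d\<close>. A word of \<open>C\<close> that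
  vanishes on the first \<open>k\<close> coordinates has weight at most \<open>n - k < d\<close>, hence is zero, so the projection
  \<open>C \<rightarrow> R\<^sup>k\<close> onto these coordinates is injective (\<open>inj_on_projection\<close>). If \<open>C\<close> is MDS, then
  \<open>\<lambda>(C) = k \<lambda>(R) = \<lambda>(R\<^sup>k)\<close>; a proper submodule of a module of finite length is strictly shorter, so the
  projection is also onto, and \<open>C\<close> is free (\<open>free_if_MDS\<close>).

  Conversely, if \<open>C\<close> is free of rank \<open>r\<close>, then \<open>\<lambda>(C) = r \<lambda>(R)\<close> and \<open>type(C) = r type(R)\<close>, so that the
  ratios \<open>\<lambda>(C) / \<lambda>(R)\<close> and \<open>type(C) / type(R)\<close> are both equal to \<open>r\<close>, and the MDS and MDT conditions are
  the same equation (\<open>MDS_iff_MDT_if_free\<close>).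

  The proof rests on three facts. Length is additive, \<open>\<lambda>(M) = \<lambda>(ker f) + \<lambda>(im f)\<close>
  (\<open>module_length_ker_im\<close>). The type of a module is the length of its socle, since the submodules of the
  socle are its subspaces over the residue field (\<open>module_type_eq_length_socle\<close>); additivity therefore
  handles the type as well. Finally, a local Artinian ring has finite length and a nonzero socle
  (\<open>finite_module_length\<close>, \<open>socle_nonzero\<close>), so that the ratios have finite numerators and nonzero
  denominators.
\<close>

section \<open>Submodules and homomorphisms\<close>

lemma (in module) submodule_in_submodule_iff:
  assumes A: "submodule R A M"
  shows "submodule R B (M\<lparr>carrier := A\<rparr>) \<longleftrightarrow> submodule R B M \<and> B \<subseteq> A"
proof -
  have m: "module R (M\<lparr>carrier := A\<rparr>)" by (rule submodule_is_module[OF A])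
  show ?thesis
    using m A module_axioms unfolding submodule_def by auto
qed

lemma (in module) carrier_submodule: "submodule R (carrier M) M"
  by (intro submodule.intro module_axioms) auto

lemma (in module) zero_submodule: "submodule R {\<zero>\<^bsub>M\<^esub>} M"
  by (intro submodule.intro module_axioms) auto

lemma (in module) submodule_inter:
  assumes "submodule R A M" "submodule R B M"
  shows "submodule R (A \<inter> B) M"
  using assms unfolding submodule_def by auto

lemma (in module) submodule_minus:
  assumes "submodule R A M" "x \<in> A" "y \<in> A"
  shows "x \<ominus>\<^bsub>M\<^esub> y \<in> A"
proof -
  have "y \<in> carrier M" using assms(1,3) submodule.subset by blast
  then have "\<ominus>\<^bsub>M\<^esub> y = (\<ominus>\<^bsub>R\<^esub> \<one>\<^bsub>R\<^esub>) \<odot>\<^bsub>M\<^esub> y" by (simp add: smult_minus_1)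
  then have "\<ominus>\<^bsub>M\<^esub> y \<in> A" using submodule.smult_closed[OF assms(1) _ assms(3)] by simp
  then show ?thesis unfolding a_minus_def using submodule.m_closed[OF assms(1,2)] by blast
qed

lemma mod_homI:
  assumes "module R M" "module R N"
    and "\<And>x. x \<in> carrier M \<Longrightarrow> f x \<in> carrier N"
    and "\<And>x y. x \<in> carrier M \<Longrightarrow> y \<in> carrier M \<Longrightarrow> f (x \<oplus>\<^bsub>M\<^esub> y) = f x \<oplus>\<^bsub>N\<^esub> f y"
    and "\<And>r x. r \<in> carrier R \<Longrightarrow> x \<in> carrier M \<Longrightarrow> f (r \<odot>\<^bsub>M\<^esub> x) = r \<odot>\<^bsub>N\<^esub> f x"
  shows "mod_hom R M N f"
  using assms by (auto intro!: mod_hom.intro mod_hom_axioms.intro simp: module_hom_def)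

lemma (in mod_hom) restrict_submodule:
  assumes A: "submodule R A M"
  shows "mod_hom R (M\<lparr>carrier := A\<rparr>) N f"
proof -
  have "x \<in> carrier M" if "x \<in> A" for x using that submodule.subset[OF A] by blast
  then show ?thesis
    by (intro mod_homI M.submodule_is_module[OF A] N.module_axioms) auto
qed

lemma (in mod_hom) image_submodule:
  assumes A: "submodule R A M"
  shows "submodule R (f ` A) N"
  using mod_hom.im_is_submodule[OF restrict_submodule[OF A]]
  by (simp add: mod_hom.im_def[OF restrict_submodule[OF A]])

lemma (in mod_hom) vimage_submodule:
  assumes B: "submodule R B N"
  shows "submodule R {x \<in> carrier M. f x \<in> B} M"
  by (intro submodule.intro M.module_axioms) (use B submodule.zero_closed submodule.m_closed submodule.smult_closed in auto)

lemma (in mod_hom) inj_on_iff_ker: "inj_on f (carrier M) \<longleftrightarrow> ker = {\<zero>\<^bsub>M\<^esub>}"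
proof
  assume i: "inj_on f (carrier M)"
  show "ker = {\<zero>\<^bsub>M\<^esub>}"
    using inj_onD[OF i, of _ "\<zero>\<^bsub>M\<^esub>"] by (auto simp: ker_def)
next
  assume k: "ker = {\<zero>\<^bsub>M\<^esub>}"
  show "inj_on f (carrier M)"
  proof (rule inj_onI)
    fix x y assume xy: "x \<in> carrier M" "y \<in> carrier M" "f x = f y"
    have "f (x \<ominus>\<^bsub>M\<^esub> y) = \<zero>\<^bsub>N\<^esub>" using xy by simp
    then have "x \<ominus>\<^bsub>M\<^esub> y \<in> ker" using xy by (simp add: ker_def)
    then show "x = y" using k xy by simp
  qed
qed

section \<open>Additivity of the length\<close>

definition submodule_chain ::
    "('a, 'r) ring_scheme \<Rightarrow> ('a, 'b, 'c) module_scheme \<Rightarrow> nat \<Rightarrow> (nat \<Rightarrow> 'b set) \<Rightarrow> bool" where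
  "submodule_chain R M k N \<longleftrightarrow>
     (\<forall>i\<le>k. submodule R (N i) M) \<and> (\<forall>i<k. N i \<subset> N (Suc i))"

text \<open>Truncating a chain gives chains of all smaller lengths, so the lengths of chains form an initial segment
  of the natural numbers. Statements about the supremum thus become statements about single chains.\<close>

lemma (in module) le_module_length_iff:
  "enat k \<le> module_length R M \<longleftrightarrow> (\<exists>N. submodule_chain R M k N)"
proof
  assume k: "enat k \<le> module_length R M"
  show "\<exists>N. submodule_chain R M k N"
  proof (rule ccontr)
    assume no: "\<not> ?thesis"
    have z: "submodule_chain R M 0 (\<lambda>_. carrier M)"
      using carrier_submodule by (simp add: submodule_chain_def)
    with no have "k \<noteq> 0" by metis
    \<comment> \<open>If no chain has length \<open>k\<close>, then every chain is shorter.\<close>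
    have "module_length R M \<le> enat (k - 1)"
      unfolding module_length_def
    proof (rule Sup_least, clarify)
      fix l N assume "\<forall>i\<le>l. submodule R (N i) M" "\<forall>i<l. N i \<subset> N (Suc i)"
      then have "k \<le> l \<Longrightarrow> submodule_chain R M k N" by (simp add: submodule_chain_def)
      with no have "l < k" by force
      then show "enat l \<le> enat (k - 1)" by simp
    qed
    with k have "enat k \<le> enat (k - 1)" by (rule order_trans)
    with \<open>k \<noteq> 0\<close> show False by simp
  qed
next
  assume "\<exists>N. submodule_chain R M k N"
  then show "enat k \<le> module_length R M"
    unfolding module_length_def submodule_chain_def by (intro Sup_upper) auto
qed

text \<open>The tool for all upper bounds: a strictly monotone function into the natural numbers grows by at least
  one along each step of a chain.\<close>

lemma module_length_le_potential:
  fixes \<phi> :: "'b set \<Rightarrow> nat"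
  assumes strict: "\<And>A B. submodule R A M \<Longrightarrow> submodule R B M \<Longrightarrow> A \<subset> B \<Longrightarrow> \<phi> A < \<phi> B"
    and bound: "\<And>A. submodule R A M \<Longrightarrow> \<phi> A \<le> c"
  shows "module_length R M \<le> enat c"
  unfolding module_length_def
proof (rule Sup_least, clarify)
  fix k N assume N: "\<forall>i\<le>k. submodule R (N i) M" "\<forall>i<k. N i \<subset> N (Suc i)"
  have "i \<le> k \<Longrightarrow> i \<le> \<phi> (N i)" for i
  proof (induction i)
    case (Suc i)
    then have "\<phi> (N i) < \<phi> (N (Suc i))" using N by (intro strict) auto
    with Suc show ?case by simp
  qed simp
  with N bound[of "N k"] show "enat k \<le> enat c" by force
qed

lemma (in module) module_length_submodule_mono:
  assumes A: "submodule R A M"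
  shows "module_length R (M\<lparr>carrier := A\<rparr>) \<le> module_length R M"
  unfolding module_length_def
  by (rule Sup_subset_mono) (use submodule_in_submodule_iff[OF A] in blast)

lemma (in module) module_length_mono:
  assumes A: "submodule R A M" and B: "submodule R B M" and "A \<subseteq> B"
  shows "module_length R (M\<lparr>carrier := A\<rparr>) \<le> module_length R (M\<lparr>carrier := B\<rparr>)"
  using module.module_length_submodule_mono[OF submodule_is_module[OF B], of A]
    submodule_in_submodule_iff[OF B] A \<open>A \<subseteq> B\<close> by simp

lemma (in module) module_length_proper:
  assumes A: "submodule R A M" and ne: "A \<noteq> carrier M"
  shows "eSuc (module_length R (M\<lparr>carrier := A\<rparr>)) \<le> module_length R M"
proof -
  interpret A: module R "M\<lparr>carrier := A\<rparr>" by (rule submodule_is_module[OF A])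
  have *: "enat (Suc k) \<le> module_length R M" if "enat k \<le> module_length R (M\<lparr>carrier := A\<rparr>)" for k
  proof -
    obtain N where N: "submodule_chain R (M\<lparr>carrier := A\<rparr>) k N"
      using \<open>enat k \<le> _\<close> A.le_module_length_iff by blast
    have "submodule_chain R M (Suc k) (\<lambda>i. if i \<le> k then N i else carrier M)"
      unfolding submodule_chain_def
    proof (intro conjI allI impI)
      fix i
      show "submodule R (if i \<le> k then N i else carrier M) M"
        using N carrier_submodule submodule_in_submodule_iff[OF A] by (simp add: submodule_chain_def)
    next
      fix i assume "i < Suc k"
      then consider "i < k" | "i = k" by linarith
      then show "(if i \<le> k then N i else carrier M) \<subset> (if Suc i \<le> k then N (Suc i) else carrier M)"
      proof cases
        case 1
        then show ?thesis using N by (simp add: submodule_chain_def)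
      next
        case 2
        have "N k \<subseteq> A" using N submodule_in_submodule_iff[OF A] by (simp add: submodule_chain_def)
        then show ?thesis using 2 ne submodule.subset[OF A] by auto
      qed
    qed
    then show ?thesis using le_module_length_iff by blast
  qed
  show ?thesis
  proof (cases "module_length R (M\<lparr>carrier := A\<rparr>)")
    case (enat l)
    then show ?thesis using *[of l] by (simp add: eSuc_enat)
  next
    case infinity
    then show ?thesis using module_length_submodule_mono[OF A] by simp
  qed
qed

lemma eSuc_le_imp_less:
  assumes "eSuc x \<le> y" "y \<noteq> \<infinity>"
  shows "x < y"
  using assms by (cases x; cases y) (auto simp: eSuc_enat)

lemma (in module) module_length_strict_mono:
  assumes A: "submodule R A M" and B: "submodule R B M" and "A \<subset> B"
    and fin: "module_length R (M\<lparr>carrier := B\<rparr>) \<noteq> \<infinity>"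
  shows "module_length R (M\<lparr>carrier := A\<rparr>) < module_length R (M\<lparr>carrier := B\<rparr>)"
proof -
  have "submodule R A (M\<lparr>carrier := B\<rparr>)"
    by (simp only: submodule_in_submodule_iff[OF B]) (use A \<open>A \<subset> B\<close> in simp)
  moreover have "A \<noteq> carrier (M\<lparr>carrier := B\<rparr>)"
    using \<open>A \<subset> B\<close> by simp
  ultimately have "eSuc (module_length R (M\<lparr>carrier := A\<rparr>)) \<le> module_length R (M\<lparr>carrier := B\<rparr>)"
    using module.module_length_proper[OF submodule_is_module[OF B], of A] by simp
  then show ?thesis using fin by (rule eSuc_le_imp_less)
qed

lemma (in module) module_length_zero: "module_length R (M\<lparr>carrier := {\<zero>\<^bsub>M\<^esub>}\<rparr>) = 0"
proof -
  have only: "A = {\<zero>\<^bsub>M\<^esub>}" if "submodule R A (M\<lparr>carrier := {\<zero>\<^bsub>M\<^esub>}\<rparr>)" for A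
  proof
    show "A \<subseteq> {\<zero>\<^bsub>M\<^esub>}" using submodule.subset[OF that] by simp
    show "{\<zero>\<^bsub>M\<^esub>} \<subseteq> A" using submodule.zero_closed[OF that] by simp
  qed
  have "module_length R (M\<lparr>carrier := {\<zero>\<^bsub>M\<^esub>}\<rparr>) \<le> enat 0"
    by (rule module_length_le_potential[where \<phi> = "\<lambda>_. 0"]) (auto dest: only)
  then show ?thesis by (simp add: zero_enat_def[symmetric])
qed

lemma (in module) module_length_pos:
  assumes A: "submodule R A M" and ne: "A \<noteq> {\<zero>\<^bsub>M\<^esub>}"
  shows "module_length R (M\<lparr>carrier := A\<rparr>) \<noteq> 0"
proof -
  have "{\<zero>\<^bsub>M\<^esub>} \<subset> A" using submodule.zero_closed[OF A] ne by auto
  then show ?thesis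
    using module_length_strict_mono[OF zero_submodule A] by (cases "module_length R (M\<lparr>carrier := A\<rparr>) = \<infinity>") auto
qed

text \<open>A chain in the kernel, followed by the preimages of a chain in the image, is a chain in the whole module.\<close>

lemma (in mod_hom) length_ker_im_le:
  "module_length R (M\<lparr>carrier := ker\<rparr>) + module_length R (N\<lparr>carrier := im\<rparr>) \<le> module_length R M"
proof -
  let ?K = "M\<lparr>carrier := ker\<rparr>" and ?I = "N\<lparr>carrier := im\<rparr>"
  interpret K: module R ?K by (rule M.submodule_is_module[OF ker_is_submodule])
  interpret I: module R ?I by (rule N.submodule_is_module[OF im_is_submodule])
  have *: "enat (a + b) \<le> module_length R M"
    if a: "enat a \<le> module_length R ?K" and b: "enat b \<le> module_length R ?I" for a b
  proof -
    obtain P where P: "submodule_chain R ?K a P" using a K.le_module_length_iff by blast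
    obtain Q where Q: "submodule_chain R ?I b Q" using b I.le_module_length_iff by blast
    define V where "V i = {x \<in> carrier M. f x \<in> Q i}" for i
    have subP: "submodule R (P i) M" "P i \<subseteq> ker" if "i \<le> a" for i
      using P that M.submodule_in_submodule_iff[OF ker_is_submodule] by (auto simp: submodule_chain_def)
    have subQ: "submodule R (Q i) N" "Q i \<subseteq> im" if "i \<le> b" for i
      using Q that N.submodule_in_submodule_iff[OF im_is_submodule] by (auto simp: submodule_chain_def)
    have subV: "submodule R (V i) M" if "i \<le> b" for i
      unfolding V_def by (rule vimage_submodule[OF subQ(1)[OF that]])
    have V_less: "V i \<subset> V (Suc i)" if "i < b" for i
    proof -
      have "Q i \<subset> Q (Suc i)" using Q that by (auto simp: submodule_chain_def)
      moreover have "Q (Suc i) \<subseteq> f ` carrier M" using subQ(2)[of "Suc i"] that by (auto simp: im_def)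
      ultimately show ?thesis unfolding V_def by blast
    qed
    have kerV: "ker \<subseteq> V 0" using submodule.zero_closed[OF subQ(1)[of 0]] by (auto simp: V_def ker_def)
    have "submodule_chain R M (a + b) (\<lambda>i. if i \<le> a then P i else V (i - a))"
      unfolding submodule_chain_def
    proof (intro conjI allI impI)
      fix i assume "i \<le> a + b"
      then show "submodule R (if i \<le> a then P i else V (i - a)) M" using subP subV by simp
    next
      fix i assume i: "i < a + b"
      consider "i < a" | "i = a" | "a < i" by linarith
      then show "(if i \<le> a then P i else V (i - a)) \<subset> (if Suc i \<le> a then P (Suc i) else V (Suc i - a))"
      proof cases
        case 1
        then show ?thesis using P by (simp add: submodule_chain_def)
      next
        case 2
        have "P a \<subseteq> V 0" using subP(2)[of a] kerV by simp
        also have "V 0 \<subset> V (Suc 0)" using V_less[of 0] i 2 by simp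
        finally show ?thesis using 2 by simp
      next
        case 3
        then show ?thesis using V_less[of "i - a"] i by (simp add: Suc_diff_le)
      qed
    qed
    then show ?thesis using M.le_module_length_iff by blast
  qed
  \<comment> \<open>Infinite lengths are covered too: chains of every length in one part exceed any bound for \<open>M\<close>.\<close>
  show ?thesis
  proof (rule ccontr)
    assume "\<not> ?thesis"
    then have lt: "module_length R M < module_length R ?K + module_length R ?I" by simp
    then obtain m where m: "module_length R M = enat m" by (cases "module_length R M") auto
    show False
    proof (cases "module_length R ?K")
      case infinity
      then show False using *[of "Suc m" 0] m by (simp add: zero_enat_def[symmetric])
    next
      case (enat a)
      show False
      proof (cases "module_length R ?I")
        case infinity
        then show False using *[of 0 "Suc m"] m by (simp add: zero_enat_def[symmetric])
      next
        case I: (enat b)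
        then show False using *[of a b] lt enat m by simp
      qed
    qed
  qed
qed

lemma (in mod_hom) submodule_eq_if_ker_im_eq:
  assumes A: "submodule R A M" and B: "submodule R B M" and "A \<subseteq> B"
    and ker_eq: "A \<inter> ker = B \<inter> ker" and im_eq: "f ` A = f ` B"
  shows "A = B"
proof (rule antisym[OF \<open>A \<subseteq> B\<close>], rule subsetI)
  fix b assume b: "b \<in> B"
  then obtain a where a: "a \<in> A" "f b = f a" using im_eq by blast
  have car: "a \<in> carrier M" "b \<in> carrier M" using a b submodule.subset[OF A] submodule.subset[OF B] by auto
  have "b \<ominus>\<^bsub>M\<^esub> a \<in> B" using M.submodule_minus[OF B b] a \<open>A \<subseteq> B\<close> by blast
  moreover have "b \<ominus>\<^bsub>M\<^esub> a \<in> ker" using a car by (simp add: ker_def)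
  ultimately have "b \<ominus>\<^bsub>M\<^esub> a \<in> A" using ker_eq by blast
  then have "(b \<ominus>\<^bsub>M\<^esub> a) \<oplus>\<^bsub>M\<^esub> a \<in> A" using a submodule.m_closed[OF A] by blast
  moreover have "(b \<ominus>\<^bsub>M\<^esub> a) \<oplus>\<^bsub>M\<^esub> a = b" using car by (simp add: a_minus_def M.M.a_assoc M.M.l_neg)
  ultimately show "b \<in> A" by simp
qed

text \<open>For the inequality \<open>\<le>\<close>, the sum of the lengths of \<open>A \<inter> ker f\<close> and \<open>f ` A\<close> serves as a potential for
  submodules \<open>A\<close>: if \<open>A \<subset> B\<close>, at least one of the two parts grows.\<close>

theorem (in mod_hom) module_length_ker_im:
  "module_length R M = module_length R (M\<lparr>carrier := ker\<rparr>) + module_length R (N\<lparr>carrier := im\<rparr>)"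
proof (rule antisym[OF _ length_ker_im_le])
  let ?lk = "\<lambda>A. module_length R (M\<lparr>carrier := A\<rparr>)" and ?li = "\<lambda>B. module_length R (N\<lparr>carrier := B\<rparr>)"
  show "module_length R M \<le> ?lk ker + ?li im"
  proof (cases "?lk ker = \<infinity> \<or> ?li im = \<infinity>")
    case True
    then show ?thesis by auto
  next
    case False
    then obtain a b where ab: "?lk ker = enat a" "?li im = enat b" by auto
    have sub: "submodule R (A \<inter> ker) M" "submodule R (f ` A) N" "f ` A \<subseteq> im" if "submodule R A M" for A
      using that M.submodule_inter[OF that ker_is_submodule] image_submodule[OF that] submodule.subset[OF that]
      by (auto simp: im_def)
    have le: "?lk (A \<inter> ker) \<le> enat a" "?li (f ` A) \<le> enat b" if "submodule R A M" for A
      using M.module_length_mono[OF sub(1)[OF that] ker_is_submodule]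
        N.module_length_mono[OF sub(2)[OF that] im_is_submodule sub(3)[OF that]] ab by auto
    have "module_length R M \<le> enat (a + b)"
    proof (rule module_length_le_potential[where \<phi> = "\<lambda>A. the_enat (?lk (A \<inter> ker)) + the_enat (?li (f ` A))"])
      fix A assume A: "submodule R A M"
      show "the_enat (?lk (A \<inter> ker)) + the_enat (?li (f ` A)) \<le> a + b"
        using le[OF A] by (cases "?lk (A \<inter> ker)"; cases "?li (f ` A)") auto
    next
      fix A B assume A: "submodule R A M" and B: "submodule R B M" and AB: "A \<subset> B"
      have weak: "?lk (A \<inter> ker) \<le> ?lk (B \<inter> ker)" "?li (f ` A) \<le> ?li (f ` B)"
        using AB by (auto intro!: M.module_length_mono N.module_length_mono sub A B)
      have fin: "?lk (B \<inter> ker) \<noteq> \<infinity>" "?li (f ` B) \<noteq> \<infinity>" using le[OF B] by (metis enat_ord_simps(5) infinity_ileE)+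
      obtain p q where pq: "?lk (B \<inter> ker) = enat p" "?li (f ` B) = enat q" using fin by auto
      obtain p' q' where pq': "?lk (A \<inter> ker) = enat p'" "?li (f ` A) = enat q'"
        using weak unfolding pq by (metis enat_ile)
      have "A \<inter> ker \<subset> B \<inter> ker \<or> f ` A \<subset> f ` B"
        using submodule_eq_if_ker_im_eq[OF A B] AB by blast
      then have "?lk (A \<inter> ker) < ?lk (B \<inter> ker) \<or> ?li (f ` A) < ?li (f ` B)"
        using M.module_length_strict_mono[OF sub(1)[OF A] sub(1)[OF B] _ fin(1)]
          N.module_length_strict_mono[OF sub(2)[OF A] sub(2)[OF B] _ fin(2)] by blast
      then show "the_enat (?lk (A \<inter> ker)) + the_enat (?li (f ` A)) < the_enat (?lk (B \<inter> ker)) + the_enat (?li (f ` B))"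
        using weak unfolding pq pq' by auto
    qed
    then show ?thesis using ab by simp
  qed
qed

lemma (in mod_hom) module_length_inj:
  assumes "inj_on f (carrier M)"
  shows "module_length R M = module_length R (N\<lparr>carrier := f ` carrier M\<rparr>)"
  using module_length_ker_im assms inj_on_iff_ker M.module_length_zero by (simp add: im_def)

text \<open>The image is isomorphic to \<open>M\<close>, so it has the full length of \<open>N\<close>; a proper submodule would be shorter.\<close>

lemma (in mod_hom) surj_if_inj_length_le:
  assumes inj: "inj_on f (carrier M)"
    and le: "module_length R N \<le> module_length R M" and fin: "module_length R N \<noteq> \<infinity>"
  shows "f ` carrier M = carrier N"
proof (rule ccontr)
  assume "\<not> ?thesis"
  then have "eSuc (module_length R (N\<lparr>carrier := f ` carrier M\<rparr>)) \<le> module_length R N"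
    by (rule N.module_length_proper[OF image_submodule[OF M.carrier_submodule]])
  then have "module_length R M < module_length R N"
    unfolding module_length_inj[OF inj] using fin by (rule eSuc_le_imp_less)
  with le show False by simp
qed

section \<open>Free modules\<close>

lemma self_module_simps [simp]:
  "carrier (self_module R) = carrier R" "add (self_module R) = add R"
  "zero (self_module R) = zero R" "smult (self_module R) = mult R"
  by (simp_all add: self_module_def)

lemma (in cring) self_module_is_module: "module R (self_module R)"
  by (rule module_criteria) (auto simp: is_cring a_assoc m_assoc l_distr r_distr a_ac intro: l_neg r_neg)

lemma (in ring) func_space_simps [simp]:
  "carrier (func_space S) = S \<rightarrow>\<^sub>E carrier R"
  "f \<oplus>\<^bsub>func_space S\<^esub> g = (\<lambda>v\<in>S. f v \<oplus> g v)"
  "\<zero>\<^bsub>func_space S\<^esub> = (\<lambda>v\<in>S. \<zero>)"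
  "c \<odot>\<^bsub>func_space S\<^esub> f = (\<lambda>v\<in>S. c \<otimes> f v)"
  by (simp_all add: func_space_def)

lemma (in cring) submodule_PiE:
  assumes J: "submodule R J (self_module R)"
  shows "submodule R (S \<rightarrow>\<^sub>E J) (func_space S)"
proof (intro submodule.intro func_space_is_module)
  show "S \<rightarrow>\<^sub>E J \<subseteq> carrier (func_space S)"
    using submodule.subset[OF J] by (auto simp: PiE_iff)
qed (use submodule.m_closed[OF J] submodule.zero_closed[OF J] submodule.smult_closed[OF J] in
    \<open>auto simp: PiE_iff\<close>)

lemma (in cring) eval_mod_hom:
  assumes "x \<in> S"
  shows "mod_hom R (func_space S) (self_module R) (\<lambda>a. a x)"
  by (rule mod_homI) (use assms func_space_is_module self_module_is_module in auto)

lemma (in cring) restrict_mod_hom: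
  assumes "T \<subseteq> S"
  shows "mod_hom R (func_space S) (func_space T) (\<lambda>a. restrict a T)"
  by (rule mod_homI) (use assms func_space_is_module in \<open>auto simp: PiE_iff subset_eq intro!: ext\<close>)

text \<open>Functions with values in an ideal \<open>J\<close> are considered because the cases \<open>J = R\<close> and \<open>J = soc(R)\<close> give the
  length and the type of a free module at once. Evaluation at a new point \<open>x\<close> maps \<open>J\<close>-valued functions on
  \<open>insert x S\<close> onto \<open>J\<close>, and its kernel is isomorphic to the functions on \<open>S\<close>.\<close>

theorem (in cring) module_length_PiE:
  assumes J: "submodule R J (self_module R)" and "finite S"
  shows "module_length R ((func_space S)\<lparr>carrier := S \<rightarrow>\<^sub>E J\<rparr>) =
         of_nat (card S) * module_length R ((self_module R)\<lparr>carrier := J\<rparr>)"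
  using \<open>finite S\<close>
proof (induction S)
  case empty
  interpret P: module R "func_space {}" by (rule func_space_is_module)
  have eq: "{} \<rightarrow>\<^sub>E J = {\<zero>\<^bsub>func_space {}\<^esub>}" by auto
  show ?case unfolding eq P.module_length_zero by simp
next
  case (insert x S)
  let ?P = "\<lambda>T. (func_space T)\<lparr>carrier := T \<rightarrow>\<^sub>E J\<rparr>"
  let ?T = "insert x S" and ?e = "\<lambda>a. a x" and ?r = "\<lambda>a. restrict a S"
  have J_car: "J \<subseteq> carrier R" and J0: "\<zero> \<in> J"
    using submodule.subset[OF J] submodule.zero_closed[OF J] by simp_all
  interpret e: mod_hom R "?P ?T" "self_module R" ?e
    by (rule mod_hom.restrict_submodule[OF eval_mod_hom submodule_PiE[OF J]]) simp
  interpret r: mod_hom R "?P ?T" "func_space S" ?r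
    by (rule mod_hom.restrict_submodule[OF restrict_mod_hom submodule_PiE[OF J]]) auto
  have im: "e.im = J"
  proof
    show "e.im \<subseteq> J" by (auto simp: e.im_def)
    show "J \<subseteq> e.im"
    proof
      fix j assume "j \<in> J"
      then have "(\<lambda>i\<in>?T. j) \<in> ?T \<rightarrow>\<^sub>E J" by auto
      then show "j \<in> e.im" unfolding e.im_def by (intro image_eqI[where x = "\<lambda>i\<in>?T. j"]) simp_all
    qed
  qed
  let ?K = "(?P ?T)\<lparr>carrier := e.ker\<rparr>"
  interpret rK: mod_hom R ?K "func_space S" ?r
    by (rule r.restrict_submodule[OF e.ker_is_submodule])
  have inj: "inj_on ?r (carrier ?K)"
  proof (rule inj_onI)
    fix a b assume a: "a \<in> carrier ?K" and b: "b \<in> carrier ?K" and ab: "?r a = ?r b"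
    have x: "a x = b x" using a b by (simp add: e.ker_def)
    have "a i = b i" if "i \<in> ?T" for i
      using that x fun_cong[OF ab, of i] by (cases "i = x") auto
    then show "a = b" using a b by (intro PiE_ext[of a ?T _ b]) (auto simp: e.ker_def)
  qed
  have onto: "?r ` carrier ?K = S \<rightarrow>\<^sub>E J"
  proof
    show "?r ` carrier ?K \<subseteq> S \<rightarrow>\<^sub>E J" by (auto simp: e.ker_def)
    show "S \<rightarrow>\<^sub>E J \<subseteq> ?r ` carrier ?K"
    proof
      fix a assume a: "a \<in> S \<rightarrow>\<^sub>E J"
      have "a(x := \<zero>) \<in> carrier ?K" using a J0 by (auto simp: e.ker_def PiE_iff extensional_def)
      moreover have "?r (a(x := \<zero>)) = a" using a insert.hyps by (auto simp: PiE_iff extensional_def)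
      ultimately show "a \<in> ?r ` carrier ?K" by (metis imageI)
    qed
  qed
  have "module_length R ?K = module_length R (?P S)"
    using rK.module_length_inj[OF inj] unfolding onto .
  then show ?case
    using e.module_length_ker_im insert.hyps insert.IH unfolding im by (simp add: algebra_simps)
qed

lemma (in cring) module_length_func_space:
  assumes "finite S"
  shows "module_length R (func_space S) = of_nat (card S) * module_length R (self_module R)"
proof -
  interpret self: module R "self_module R" by (rule self_module_is_module)
  have f: "(func_space S)\<lparr>carrier := S \<rightarrow>\<^sub>E carrier R\<rparr> = func_space S" by (simp add: func_space_def)
  have s: "(self_module R)\<lparr>carrier := carrier R\<rparr> = self_module R" by (simp add: self_module_def)
  show ?thesis
    using module_length_PiE[OF self.carrier_submodule assms] unfolding self_module_simps f s .
qed

lemma (in module) lincomb_bij_span: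
  assumes B: "finite B" "B \<subseteq> carrier M" and li: "lin_indpt B"
  shows "bij_betw (\<lambda>a. lincomb a B) (carrier (func_space B)) (span B)"
proof -
  interpret l: mod_hom R "func_space B" M "\<lambda>a. lincomb a B"
    by (rule lincomb_is_mod_hom[OF B])
  have "l.ker = {\<zero>\<^bsub>func_space B\<^esub>}"
  proof
    show "l.ker \<subseteq> {\<zero>\<^bsub>func_space B\<^esub>}"
    proof
      fix a assume a: "a \<in> l.ker"
      then have car: "a \<in> B \<rightarrow>\<^sub>E carrier R" and "lincomb a B = \<zero>\<^bsub>M\<^esub>" by (simp_all add: l.ker_def)
      then have "a v = \<zero>\<^bsub>R\<^esub>" if "v \<in> B" for v
        using li lin_dep_crit[OF B(1) subset_refl _ that, of a] by (auto simp: PiE_iff)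
      then have "a = (\<lambda>v\<in>B. \<zero>\<^bsub>R\<^esub>)" using car by (auto simp: PiE_iff extensional_def)
      then show "a \<in> {\<zero>\<^bsub>func_space B\<^esub>}" by simp
    qed
    show "{\<zero>\<^bsub>func_space B\<^esub>} \<subseteq> l.ker"
      using l.f0_is_0 l.M.M.zero_closed unfolding l.ker_def by blast
  qed
  then have "inj_on (\<lambda>a. lincomb a B) (carrier (func_space B))" by (simp only: l.inj_on_iff_ker)
  moreover have "(\<lambda>a. lincomb a B) ` carrier (func_space B) = span B"
  proof -
    have "lincomb a B \<in> (\<lambda>a. lincomb a B) ` carrier (func_space B)" if a: "a \<in> B \<rightarrow> carrier R" for a
    proof -
      have "lincomb a B = lincomb (restrict a B) B"
        using a B by (intro lincomb_cong) auto
      moreover have "restrict a B \<in> carrier (func_space B)" using a by auto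
      ultimately show ?thesis by blast
    qed
    moreover have "a \<in> B \<rightarrow> carrier R" if "a \<in> carrier (func_space B)" for a
      using that by (simp add: PiE_def)
    ultimately show ?thesis
      unfolding finite_span[OF B] by blast
  qed
  ultimately show ?thesis by (simp add: bij_betw_def)
qed

lemma (in module) module_length_span:
  assumes B: "finite B" "B \<subseteq> carrier M" and li: "lin_indpt B"
  shows "module_length R (M\<lparr>carrier := span B\<rparr>) = of_nat (card B) * module_length R (self_module R)"
proof -
  interpret l: mod_hom R "func_space B" M "\<lambda>a. lincomb a B"
    by (rule lincomb_is_mod_hom[OF B])
  have "module_length R (func_space B) = module_length R (M\<lparr>carrier := span B\<rparr>)"
    using l.module_length_inj lincomb_bij_span[OF assms] by (simp add: bij_betw_def)
  then show ?thesis using R.module_length_func_space[OF B(1)] by simp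
qed

text \<open>Each finite subset of \<open>B\<close> spans a free submodule, whose length is at least its rank. The infinite
  case is reduced to a subset with \<open>l + 1\<close> elements.\<close>

lemma (in module) card_lin_indpt_le_length:
  assumes pos: "module_length R (self_module R) \<noteq> 0" and l: "module_length R M = enat l"
    and B: "B \<subseteq> carrier M" and li: "lin_indpt B"
  shows "finite B \<and> card B \<le> l"
proof -
  have fin: "card A \<le> l" if "finite A" "A \<subseteq> B" for A
  proof -
    have A: "A \<subseteq> carrier M" using that B by blast
    have "1 \<le> module_length R (self_module R)" using pos by (simp add: one_eSuc ileI1)
    then have "enat (card A) \<le> of_nat (card A) * module_length R (self_module R)"
      using mult_left_mono[of 1 "module_length R (self_module R)" "of_nat (card A)"]
      by (simp add: of_nat_eq_enat)
    also have "\<dots> = module_length R (M\<lparr>carrier := span A\<rparr>)"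
      by (rule module_length_span[symmetric, OF \<open>finite A\<close> A subset_li_is_li[OF li \<open>A \<subseteq> B\<close>]])
    also have "\<dots> \<le> enat l"
      using module_length_submodule_mono[OF span_is_submodule[OF A]] l by simp
    finally show ?thesis by simp
  qed
  moreover have "finite B"
  proof (rule ccontr)
    assume "infinite B"
    then obtain A where "A \<subseteq> B" "finite A" "card A = Suc l"
      using infinite_arbitrarily_large by blast
    with fin show False by fastforce
  qed
  ultimately show ?thesis by simp
qed

text \<open>The preimages of the unit vectors form a basis: the coordinates of the image of a linear combination of
  them are its coefficients.\<close>

lemma (in cring) free_module_if_bij_func_space:
  assumes hom: "mod_hom R M (func_space T) f" and "finite T" and nontriv: "\<one> \<noteq> \<zero>"
    and bij: "bij_betw f (carrier M) (carrier (func_space T))"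
  shows "free_module R M"
proof -
  interpret f: mod_hom R M "func_space T" f by (rule hom)
  interpret self: module R "self_module R" by (rule self_module_is_module)
  define e where "e t = (\<lambda>u\<in>T. if u = t then \<one> else \<zero>)" for t
  define b where "b t = inv_into (carrier M) f (e t)" for t
  have "e t \<in> f ` carrier M" for t
    using bij by (simp add: e_def bij_betw_def)
  then have b_car: "b t \<in> carrier M" and fb: "f (b t) = e t" for t
    unfolding b_def by (simp_all add: inv_into_into f_inv_into_f)
  have b_inj: "b t = b u \<longleftrightarrow> t = u" if "t \<in> T" for t u
  proof
    assume "b t = b u"
    then have "e t t = e u t" using fb by metis
    then show "t = u" using that nontriv by (simp add: e_def split: if_splits)
  qed simp
  have coord: "f (f.M.lincomb a (b ` T)) t = a (b t)" if a: "a \<in> b ` T \<rightarrow> carrier R" and t: "t \<in> T" for a t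
  proof -
    have ev: "mod_hom R M (self_module R) (\<lambda>x. f x t)"
    proof (rule mod_homI[OF f.M.module_axioms self.module_axioms])
      show "f x t \<in> carrier (self_module R)" if "x \<in> carrier M" for x
        using f.f_im[OF that] t by (auto simp: PiE_iff)
    qed (use t in auto)
    have "f (f.M.lincomb a (b ` T)) t = (\<Oplus>\<^bsub>self_module R\<^esub>v\<in>b ` T. f (a v \<odot>\<^bsub>M\<^esub> v) t)"
      unfolding f.M.lincomb_def by (rule mod_hom.hom_sum[OF ev]) (use a b_car in auto)
    also have "\<dots> = (\<Oplus>\<^bsub>self_module R\<^esub>v\<in>b ` T. if b t = v then a v else \<zero>)"
    proof (rule self.M.finsum_cong')
      fix v assume v: "v \<in> b ` T"
      then obtain u where u: "u \<in> T" "v = b u" by blast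
      have "a v \<in> carrier R" "v \<in> carrier M" using a v u b_car by auto
      then show "f (a v \<odot>\<^bsub>M\<^esub> v) t = (if b t = v then a v else \<zero>)"
        using u t fb b_inj[OF t, of u] by (simp add: e_def)
    qed (use a in auto)
    also have "\<dots> = a (b t)"
      using self.M.finsum_singleton[of "b t" "b ` T" a] t a \<open>finite T\<close> by (simp cong: if_cong)
    finally show ?thesis .
  qed
  have B: "finite (b ` T)" "b ` T \<subseteq> carrier M" using \<open>finite T\<close> b_car by auto
  have "\<not> f.M.lin_dep (b ` T)"
  proof (rule f.M.finite_lin_indpt2[OF B])
    fix a assume a: "a \<in> b ` T \<rightarrow> carrier R" "f.M.lincomb a (b ` T) = \<zero>\<^bsub>M\<^esub>"
    have "a (b t) = \<zero>" if "t \<in> T" for t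
      using coord[OF a(1) that] a(2) that by simp
    then show "\<forall>v\<in>b ` T. a v = \<zero>" by blast
  qed
  moreover have "carrier M \<subseteq> f.M.span (b ` T)"
  proof
    fix x assume x: "x \<in> carrier M"
    define a where "a v = f x (inv_into T b v)" for v
    have "inj_on b T" using b_inj by (auto intro: inj_onI)
    then have ab: "a (b t) = f x t" if "t \<in> T" for t
      using that by (simp add: a_def)
    have a: "a \<in> b ` T \<rightarrow> carrier R" using ab f.f_im[OF x] by (auto simp: PiE_iff)
    have lin: "f.M.lincomb a (b ` T) \<in> carrier M" by (rule f.M.lincomb_closed[OF B(2) a])
    have "f (f.M.lincomb a (b ` T)) = f x"
    proof (rule PiE_ext)
      show "f (f.M.lincomb a (b ` T)) \<in> T \<rightarrow>\<^sub>E carrier R" using f.f_im[OF lin] by simp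
      show "f x \<in> T \<rightarrow>\<^sub>E carrier R" using f.f_im[OF x] by simp
    qed (simp add: coord[OF a] ab)
    then have "f.M.lincomb a (b ` T) = x"
      using bij lin x by (auto simp: bij_betw_def dest: inj_onD)
    then show "x \<in> f.M.span (b ` T)" using a f.M.finite_span[OF B] by blast
  qed
  ultimately show ?thesis
    unfolding free_module_def using B(2) f.M.span_is_subset2[OF B(2)] by blast
qed

section \<open>The type as the length of the socle\<close>

lemma (in module) socle_submodule:
  assumes I: "\<mm> \<subseteq> carrier R"
  shows "submodule R (socle R \<mm> M) M"
proof (intro submodule.intro module_axioms)
  show "socle R \<mm> M \<subseteq> carrier M" by (auto simp: socle_def)
  show "v \<oplus>\<^bsub>M\<^esub> w \<in> socle R \<mm> M" if "v \<in> socle R \<mm> M" "w \<in> socle R \<mm> M" for v w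
    using that I by (auto simp: socle_def smult_r_distr)
  show "\<zero>\<^bsub>M\<^esub> \<in> socle R \<mm> M" using I by (auto simp: socle_def)
  show "c \<odot>\<^bsub>M\<^esub> v \<in> socle R \<mm> M" if "c \<in> carrier R" "v \<in> socle R \<mm> M" for c v
  proof -
    have "a \<odot>\<^bsub>M\<^esub> (c \<odot>\<^bsub>M\<^esub> v) = c \<odot>\<^bsub>M\<^esub> (a \<odot>\<^bsub>M\<^esub> v)" if "a \<in> \<mm>" for a
    proof -
      have car: "a \<in> carrier R" "v \<in> carrier M" "c \<in> carrier R"
        using \<open>a \<in> \<mm>\<close> I \<open>c \<in> carrier R\<close> \<open>v \<in> socle R \<mm> M\<close> by (auto simp: socle_def)
      have "a \<odot>\<^bsub>M\<^esub> (c \<odot>\<^bsub>M\<^esub> v) = (a \<otimes>\<^bsub>R\<^esub> c) \<odot>\<^bsub>M\<^esub> v" using car by (simp add: smult_assoc1)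
      also have "a \<otimes>\<^bsub>R\<^esub> c = c \<otimes>\<^bsub>R\<^esub> a" using car by (simp add: R.m_comm)
      also have "(c \<otimes>\<^bsub>R\<^esub> a) \<odot>\<^bsub>M\<^esub> v = c \<odot>\<^bsub>M\<^esub> (a \<odot>\<^bsub>M\<^esub> v)" using car by (simp add: smult_assoc1)
      finally show ?thesis .
    qed
    then show ?thesis using that by (auto simp: socle_def)
  qed
qed

lemma (in cring) socle_func_space:
  assumes I: "\<mm> \<subseteq> carrier R"
  shows "socle R \<mm> (func_space S) = S \<rightarrow>\<^sub>E socle R \<mm> (self_module R)"
proof -
  have "(\<lambda>v\<in>S. c \<otimes> f v) = (\<lambda>v\<in>S. \<zero>) \<longleftrightarrow> (\<forall>v\<in>S. c \<otimes> f v = \<zero>)" for c f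
    by (auto simp: restrict_def fun_eq_iff)
  then show ?thesis by (auto simp: socle_def PiE_iff extensional_def)
qed

lemma (in mod_hom) image_socle:
  assumes bij: "bij_betw f (carrier M) (carrier N)" and I: "\<mm> \<subseteq> carrier R"
  shows "f ` socle R \<mm> M = socle R \<mm> N"
proof -
  have inj: "inj_on f (carrier M)" and surj: "f ` carrier M = carrier N"
    using bij by (auto simp: bij_betw_def)
  have iff: "a \<odot>\<^bsub>N\<^esub> f v = \<zero>\<^bsub>N\<^esub> \<longleftrightarrow> a \<odot>\<^bsub>M\<^esub> v = \<zero>\<^bsub>M\<^esub>" if "a \<in> carrier R" "v \<in> carrier M" for a v
  proof -
    have "a \<odot>\<^bsub>N\<^esub> f v = \<zero>\<^bsub>N\<^esub> \<longleftrightarrow> f (a \<odot>\<^bsub>M\<^esub> v) = f \<zero>\<^bsub>M\<^esub>" using that by simp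
    also have "\<dots> \<longleftrightarrow> a \<odot>\<^bsub>M\<^esub> v = \<zero>\<^bsub>M\<^esub>" using that by (intro inj_on_eq_iff[OF inj]) simp_all
    finally show ?thesis .
  qed
  show ?thesis
  proof
    show "f ` socle R \<mm> M \<subseteq> socle R \<mm> N" using I iff by (auto simp: socle_def)
    show "socle R \<mm> N \<subseteq> f ` socle R \<mm> M"
    proof
      fix w assume w: "w \<in> socle R \<mm> N"
      then obtain v where v: "v \<in> carrier M" "w = f v" using surj by (auto simp: socle_def)
      then have "v \<in> socle R \<mm> M" using w I iff by (auto simp: socle_def)
      then show "w \<in> f ` socle R \<mm> M" using v by blast
    qed
  qed
qed

lemma (in mod_hom) module_length_socle_bij:
  assumes bij: "bij_betw f (carrier M) (carrier N)" and I: "\<mm> \<subseteq> carrier R"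
  shows "module_length R (M\<lparr>carrier := socle R \<mm> M\<rparr>) = module_length R (N\<lparr>carrier := socle R \<mm> N\<rparr>)"
proof -
  interpret s: mod_hom R "M\<lparr>carrier := socle R \<mm> M\<rparr>" N f
    by (rule restrict_submodule[OF M.socle_submodule[OF I]])
  have "inj_on f (carrier (M\<lparr>carrier := socle R \<mm> M\<rparr>))"
    by (rule inj_on_subset[OF bij_betw_imp_inj_on[OF bij]]) (auto simp: socle_def)
  from s.module_length_inj[OF this] show ?thesis
    by (simp add: image_socle[OF bij I])
qed

text \<open>A field has only the two trivial ideals.\<close>

lemma (in field) module_length_self: "module_length R (self_module R) = 1"
proof (rule antisym)
  interpret self: module R "self_module R" by (rule self_module_is_module)
  have whole: "A = carrier R" if A: "submodule R A (self_module R)" and "A \<noteq> {\<zero>}" for A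
  proof -
    obtain a where a: "a \<in> A" "a \<noteq> \<zero>"
      using submodule.zero_closed[OF A] \<open>A \<noteq> {\<zero>}\<close> by auto
    have AR: "A \<subseteq> carrier R" using submodule.subset[OF A] by simp
    then have "a \<in> Units R" using a field_Units by auto
    have "r \<in> A" if r: "r \<in> carrier R" for r
    proof -
      have "(r \<otimes> inv a) \<otimes> a \<in> A"
        using submodule.smult_closed[OF A, of "r \<otimes> inv a" a] a r \<open>a \<in> Units R\<close> by simp
      moreover have "(r \<otimes> inv a) \<otimes> a = r"
        using \<open>a \<in> Units R\<close> r a AR by (simp add: m_assoc subset_iff)
      ultimately show ?thesis by simp
    qed
    then show ?thesis using AR by blast
  qed
  have "module_length R (self_module R) \<le> enat 1"
  proof (rule module_length_le_potential[where \<phi> = "\<lambda>A. if A = {\<zero>} then 0 else 1"])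
    fix A B assume A: "submodule R A (self_module R)" and B: "submodule R B (self_module R)" and "A \<subset> B"
    have "A = {\<zero>}" using whole[OF A] submodule.subset[OF B] \<open>A \<subset> B\<close> by auto
    then show "(if A = {\<zero>} then 0 else 1) < (if B = {\<zero>} then 0 else (1::nat))"
      using \<open>A \<subset> B\<close> by auto
  qed auto
  then show "module_length R (self_module R) \<le> 1" by (simp add: one_enat_def)
  have "module_length R ((self_module R)\<lparr>carrier := carrier R\<rparr>) \<noteq> 0"
  proof (rule self.module_length_pos)
    show "submodule R (carrier R) (self_module R)" using self.carrier_submodule by simp
    show "carrier R \<noteq> {\<zero>\<^bsub>self_module R\<^esub>}" using one_closed zero_not_one by fastforce
  qed
  moreover have "(self_module R)\<lparr>carrier := carrier R\<rparr> = self_module R"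
    by (simp add: self_module_def)
  ultimately show "1 \<le> module_length R (self_module R)" by (simp add: ileI1 one_eSuc)
qed

text \<open>Independent sets have at most \<open>d\<close> elements, so there is a maximal one; it is a basis, and \<open>V\<close> has the length
  of a free module of that rank over the field \<open>K\<close>, which itself has length 1.\<close>

theorem (in vectorspace) dim_eq_module_length:
  assumes l: "module_length K V = enat d"
  shows "dim = d"
proof -
  have one: "module_length K (self_module K) = 1" by (rule module_length_self)
  let ?P = "\<lambda>S. S \<subseteq> carrier V \<and> lin_indpt S"
  have "?P {}" by (simp add: lin_dep_def)
  then obtain A where A: "finite A" "maximal A ?P"
    using maximal_exists[of ?P d "{}"] card_lin_indpt_le_length[OF _ l] one by auto
  then have basis: "basis A" by (intro max_li_is_basis)
  then have "module_length K (V\<lparr>carrier := span A\<rparr>) = of_nat (card A) * 1"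
    using module_length_span[OF A(1)] one by (simp add: basis_def)
  moreover have "V\<lparr>carrier := span A\<rparr> = V" using basis by (simp add: basis_def)
  ultimately have "enat (card A) = enat d" using l by (simp add: of_nat_eq_enat)
  then show ?thesis using dim_basis[OF A(1) basis] by simp
qed

text \<open>On the socle, a coset of \<open>\<mm>\<close> acts like each of its representatives. So subspaces and submodules of the socle
  are the same sets.\<close>

lemma (in module) module_length_socle_space:
  assumes m: "maximalideal \<mm> R"
  shows "module_length (R Quot \<mm>) (socle_space R \<mm> M) = module_length R (M\<lparr>carrier := socle R \<mm> M\<rparr>)"
proof -
  interpret m: maximalideal \<mm> R by fact
  have id: "ideal \<mm> R" by (rule m.is_ideal)
  interpret V: vectorspace "R Quot \<mm>" "socle_space R \<mm> M" by (rule socle_space_vectorspace[OF m])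
  let ?S = "M\<lparr>carrier := socle R \<mm> M\<rparr>"
  have S: "module R ?S" by (rule submodule_is_module[OF socle_submodule]) (use m.a_subset in blast)
  have simps: "carrier (socle_space R \<mm> M) = socle R \<mm> M" "add (socle_space R \<mm> M) = add M"
    "zero (socle_space R \<mm> M) = zero M"
    by (simp_all add: socle_space_def)
  have quot: "carrier (R Quot \<mm>) = (\<lambda>r. \<mm> +>\<^bsub>R\<^esub> r) ` carrier R"
    by (auto simp: FactRing_def A_RCOSETS_def')
  have "submodule (R Quot \<mm>) A (socle_space R \<mm> M) \<longleftrightarrow> submodule R A ?S" for A
  proof
    assume A: "submodule (R Quot \<mm>) A (socle_space R \<mm> M)"
    have sub: "A \<subseteq> socle R \<mm> M" using submodule.subset[OF A] by (simp add: simps)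
    have "r \<odot>\<^bsub>M\<^esub> v \<in> A" if "r \<in> carrier R" "v \<in> A" for r v
      using submodule.smult_closed[OF A, of "\<mm> +>\<^bsub>R\<^esub> r" v] coset_smult[OF id, of r v] that sub
      by (auto simp: quot)
    then show "submodule R A ?S"
      using submodule.m_closed[OF A] submodule.zero_closed[OF A] sub
      by (intro submodule.intro S) (simp_all add: simps)
  next
    assume A: "submodule R A ?S"
    have sub: "A \<subseteq> socle R \<mm> M" using submodule.subset[OF A] by simp
    have "x \<odot>\<^bsub>socle_space R \<mm> M\<^esub> v \<in> A" if x: "x \<in> carrier (R Quot \<mm>)" and v: "v \<in> A" for x v
    proof -
      obtain r where r: "r \<in> carrier R" "x = \<mm> +>\<^bsub>R\<^esub> r" using x quot by auto
      then show ?thesis using coset_smult[OF id, of r v] submodule.smult_closed[OF A, of r v] v sub by auto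
    qed
    then show "submodule (R Quot \<mm>) A (socle_space R \<mm> M)"
      using submodule.m_closed[OF A] submodule.zero_closed[OF A] sub
      by (intro submodule.intro V.module_axioms) (simp_all add: simps)
  qed
  then show ?thesis by (simp add: module_length_def)
qed

theorem (in module) module_type_eq_length_socle:
  assumes m: "maximalideal \<mm> R"
    and l: "module_length R (M\<lparr>carrier := socle R \<mm> M\<rparr>) = enat d"
  shows "module_type R \<mm> M = d"
  unfolding module_type_def
  by (rule vectorspace.dim_eq_module_length[OF socle_space_vectorspace[OF m]])
    (simp add: module_length_socle_space[OF m] l)

text \<open>One rank \<open>k\<close> serves for both equations, which is what makes the MDS and MDT ratios agree. Finite length is
  needed to exclude infinite bases.\<close>

lemma (in module) free_module_lengths:
  assumes free: "free_module R M" and I: "\<mm> \<subseteq> carrier R"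
    and pos: "module_length R (self_module R) \<noteq> 0" and fin: "module_length R M \<noteq> \<infinity>"
  obtains k where
    "module_length R M = of_nat k * module_length R (self_module R)"
    "module_length R (M\<lparr>carrier := socle R \<mm> M\<rparr>) =
     of_nat k * module_length R ((self_module R)\<lparr>carrier := socle R \<mm> (self_module R)\<rparr>)"
proof -
  obtain B where B: "B \<subseteq> carrier M" and li: "lin_indpt B" and gen: "span B = carrier M"
    using free unfolding free_module_def by blast
  obtain l where l: "module_length R M = enat l" using fin by auto
  have "finite B" using card_lin_indpt_le_length[OF pos l B li] by simp
  interpret self: module R "self_module R" by (rule R.self_module_is_module)
  interpret l: mod_hom R "func_space B" M "\<lambda>a. lincomb a B"
    by (rule lincomb_is_mod_hom[OF \<open>finite B\<close> B])
  have "M\<lparr>carrier := span B\<rparr> = M" by (simp add: gen)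
  then have "module_length R M = of_nat (card B) * module_length R (self_module R)"
    using module_length_span[OF \<open>finite B\<close> B li] by simp
  moreover have "module_length R (M\<lparr>carrier := socle R \<mm> M\<rparr>) =
     of_nat (card B) * module_length R ((self_module R)\<lparr>carrier := socle R \<mm> (self_module R)\<rparr>)"
    using l.module_length_socle_bij[OF _ I] lincomb_bij_span[OF \<open>finite B\<close> B li]
      R.module_length_PiE[OF self.socle_submodule[OF I] \<open>finite B\<close>]
    unfolding gen R.socle_func_space[OF I] by simp
  ultimately show ?thesis by (rule that)
qed

section \<open>Finite length and socle of a local Artinian ring\<close>

lemma (in cring) ideal_iff_submodule: "ideal I R \<longleftrightarrow> submodule R I (self_module R)"
proof
  interpret self: module R "self_module R" by (rule self_module_is_module)
  show "submodule R I (self_module R)" if "ideal I R"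
  proof -
    interpret ideal I R by fact
    show ?thesis
      by (intro submodule.intro self.module_axioms) (auto intro: I_l_closed)
  qed
  show "ideal I R" if I: "submodule R I (self_module R)"
  proof (rule idealI[OF ring_axioms])
    have IR: "I \<subseteq> carrier R" using submodule.subset[OF I] by simp
    have sc: "x \<otimes> a \<in> I" if "a \<in> I" "x \<in> carrier R" for a x
      using submodule.smult_closed[OF I that(2,1)] by simp
    show "subgroup I (add_monoid R)"
    proof (rule add.subgroupI[OF IR])
      show "I \<noteq> {}" using submodule.zero_closed[OF I] by auto
      show "\<ominus> a \<in> I" if "a \<in> I" for a
        using sc[OF that, of "\<ominus> \<one>"] that IR by (simp add: l_minus subset_iff)
      show "a \<oplus> b \<in> I" if "a \<in> I" "b \<in> I" for a b
        using submodule.m_closed[OF I that] by simp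
    qed
    show "x \<otimes> a \<in> I" if "a \<in> I" "x \<in> carrier R" for a x by (rule sc[OF that])
    show "a \<otimes> x \<in> I" if "a \<in> I" "x \<in> carrier R" for a x
      using sc[OF that] m_comm[of a x] that IR by auto
  qed
qed

lemma (in artinian_cring) minimal_ideal_exists:
  assumes "ideal I R" "P I"
  shows "\<exists>J. ideal J R \<and> P J \<and> (\<forall>L. ideal L R \<longrightarrow> L \<subset> J \<longrightarrow> \<not> P L)"
proof (rule ccontr)
  assume no: "\<not> ?thesis"
  have step: "\<exists>L. (ideal L R \<and> P L) \<and> L \<subset> J" if "ideal J R \<and> P J" for J
    using no that by blast
  have "\<exists>f. \<forall>k::nat. (ideal (f k) R \<and> P (f k)) \<and> f (Suc k) \<subset> f k"
    by (rule dependent_nat_choice) (use assms step in blast)+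
  then obtain f where f: "\<And>k::nat. ideal (f k) R" "\<And>k. f (Suc k) \<subset> f k" by blast
  have "\<exists>N. \<forall>k\<ge>N. f k = f N"
    by (rule descending_chain_condition[of f, OF f(1) psubset_imp_subset[OF f(2)]])
  then obtain N where N: "\<forall>k\<ge>N. f k = f N" ..
  have "f (Suc N) = f N" using N[rule_format, of "Suc N"] by simp
  with f(2)[of N] show False by simp
qed

text \<open>An application of Zorn's lemma that is needed twice: with \<open>v = \<one>\<close> it yields maximal ideals, and in a
  semisimple module it yields maximal submodules.\<close>

lemma (in module) maximal_submodule_avoiding:
  assumes N0: "submodule R N0 M" and "v \<notin> N0"
  obtains N where "submodule R N M" "N0 \<subseteq> N" "v \<notin> N"
    "\<And>L. submodule R L M \<Longrightarrow> N \<subseteq> L \<Longrightarrow> v \<notin> L \<Longrightarrow> L = N"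
proof -
  let ?A = "{N. submodule R N M \<and> N0 \<subseteq> N \<and> v \<notin> N}"
  have "\<exists>N\<in>?A. \<forall>L\<in>?A. N \<subseteq> L \<longrightarrow> L = N"
  proof (rule subset_Zorn_nonempty)
    show "?A \<noteq> {}" using assms by blast
  next
    fix \<C> assume "\<C> \<noteq> {}" and "subset.chain ?A \<C>"
    then have sub: "\<C> \<subseteq> ?A" and total: "\<And>A B. A \<in> \<C> \<Longrightarrow> B \<in> \<C> \<Longrightarrow> A \<subseteq> B \<or> B \<subseteq> A"
      by (simp_all add: subset_chain_def)
    have "submodule R (\<Union>\<C>) M"
    proof (rule nested_union_vs[where I = \<C> and N = "\<lambda>N. N"])
      show "submodule R A M" if "A \<in> \<C>" for A using that sub by auto
      show "\<exists>L. L \<in> \<C> \<and> A \<subseteq> L \<and> B \<subseteq> L" if "A \<in> \<C>" "B \<in> \<C>" for A B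
        using total[OF that] that by blast
    qed (simp_all add: \<open>\<C> \<noteq> {}\<close>)
    moreover have "N0 \<subseteq> \<Union>\<C>" using sub \<open>\<C> \<noteq> {}\<close> by auto
    moreover have "v \<notin> \<Union>\<C>" using sub by auto
    ultimately show "\<Union>\<C> \<in> ?A" by simp
  qed
  then obtain N where "N \<in> ?A" and max: "\<forall>L\<in>?A. N \<subseteq> L \<longrightarrow> L = N" ..
  then have N: "submodule R N M" "N0 \<subseteq> N" "v \<notin> N" by simp_all
  show ?thesis
  proof (rule that[OF N])
    show "L = N" if "submodule R L M" "N \<subseteq> L" "v \<notin> L" for L
      using max that N(2) by auto
  qed
qed

text \<open>A maximal ideal that contains \<open>a\<close> would have to be \<open>\<mm>\<close>. So the ideal generated by \<open>a\<close> is not proper.\<close>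

lemma (in local_cring) unit_if_notin_maximal:
  assumes a: "a \<in> carrier R" and notin: "a \<notin> \<mm>"
  shows "a \<in> Units R"
proof -
  interpret self: module R "self_module R" by (rule self_module_is_module)
  have "\<one> \<in> PIdl a"
  proof (rule ccontr)
    assume "\<one> \<notin> PIdl a"
    then obtain N where N: "submodule R N (self_module R)" "PIdl a \<subseteq> N" "\<one> \<notin> N"
      and max: "\<And>L. submodule R L (self_module R) \<Longrightarrow> N \<subseteq> L \<Longrightarrow> \<one> \<notin> L \<Longrightarrow> L = N"
      using self.maximal_submodule_avoiding cgenideal_ideal[OF a] unfolding ideal_iff_submodule by metis
    have "maximalideal N R"
    proof (rule maximalidealI)
      show "ideal N R" using N by (simp add: ideal_iff_submodule)
      show "carrier R \<noteq> N" using N by blast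
      show "J = N \<or> J = carrier R" if "ideal J R" "N \<subseteq> J" "J \<subseteq> carrier R" for J
        using max[of J] that ideal.one_imp_carrier[OF \<open>ideal J R\<close>] ideal_iff_submodule by blast
    qed
    then have "N = \<mm>" by (rule maximal_unique)
    then show False using N notin cgenideal_self[OF a] by blast
  qed
  then obtain r where "r \<in> carrier R" "\<one> = r \<otimes> a" unfolding cgenideal_def by blast
  then show ?thesis using a m_comm[of r a] unfolding Units_def by auto
qed

lemma (in local_cring) maximal_subset_carrier: "\<mm> \<subseteq> carrier R"
  using maximal maximalideal.axioms(1) ideal.axioms(1) additive_subgroup.a_subset by blast

lemma (in local_cring) one_notin_maximal: "\<one> \<notin> \<mm>"
  using maximal ideal.one_imp_carrier maximalideal.axioms(1) maximalideal.I_notcarr by blast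

lemma (in local_cring) one_not_zero: "\<one> \<noteq> \<zero>"
proof -
  interpret m: ideal \<mm> R using maximal by (rule maximalideal.axioms(1))
  show ?thesis using one_notin_maximal m.zero_closed by metis
qed

text \<open>The powers of the ideal generated by \<open>x\<close> become stationary, so \<open>x\<^sup>N = r x\<^sup>N x\<close> for some \<open>r\<close>, that is,
  \<open>x\<^sup>N (1 - r x) = 0\<close>, where \<open>1 - r x\<close> is a unit.\<close>

lemma (in local_artinian_ring) nilpotent_if_in_maximal:
  assumes x: "x \<in> \<mm>"
  shows "\<exists>k::nat. x [^] k = \<zero>"
proof -
  interpret m: ideal \<mm> R using maximal by (rule maximalideal.axioms(1))
  have xR: "x \<in> carrier R" using x maximal_subset_carrier by blast
  have "\<exists>N::nat. \<forall>k\<ge>N. PIdl (x [^] k) = PIdl (x [^] N)"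
  proof (rule descending_chain_condition)
    show "ideal (PIdl (x [^] k)) R" for k :: nat using xR by (intro cgenideal_ideal) simp
    show "PIdl (x [^] Suc k) \<subseteq> PIdl (x [^] k)" for k :: nat
    proof (rule cgenideal_minimal)
      show "ideal (PIdl (x [^] k)) R" using xR by (intro cgenideal_ideal) simp
      have "x [^] Suc k = x \<otimes> x [^] k" using xR m_comm[of x "x [^] k"] by simp
      then show "x [^] Suc k \<in> PIdl (x [^] k)" unfolding cgenideal_def using xR by blast
    qed
  qed
  then obtain N :: nat where N: "\<forall>k\<ge>N. PIdl (x [^] k) = PIdl (x [^] N)" ..
  have "PIdl (x [^] Suc N) = PIdl (x [^] N)" using N[rule_format, of "Suc N"] by simp
  then have "x [^] N \<in> PIdl (x [^] Suc N)" using cgenideal_self[of "x [^] N"] xR by simp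
  then obtain r where r: "r \<in> carrier R" "x [^] N = r \<otimes> x [^] Suc N" unfolding cgenideal_def by blast
  let ?u = "\<one> \<ominus> r \<otimes> x"
  have "?u \<notin> \<mm>"
  proof
    assume "?u \<in> \<mm>"
    then have "?u \<oplus> r \<otimes> x \<in> \<mm>" using x r m.I_l_closed[of x r] m.a_closed by blast
    moreover have "?u \<oplus> r \<otimes> x = \<one>" using r xR by (simp add: a_minus_def a_assoc l_neg)
    ultimately show False using one_notin_maximal by simp
  qed
  then have u: "?u \<in> Units R" using r xR by (intro unit_if_notin_maximal) simp_all
  have uR: "?u \<in> carrier R" using u by (rule Units_closed)
  have "x [^] N \<otimes> ?u = x [^] N \<ominus> r \<otimes> (x [^] N \<otimes> x)"
    using r(1) xR by (simp add: a_minus_def r_distr r_minus m_lcomm)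
  also have "\<dots> = x [^] N \<ominus> x [^] N" using r(2) by simp
  finally have "x [^] N \<otimes> ?u = \<zero>" using xR by simp
  then have "(x [^] N \<otimes> ?u) \<otimes> inv ?u = \<zero>" using u by simp
  then have "x [^] N = \<zero>" using u xR uR by (simp only: m_assoc nat_pow_closed Units_inv_closed Units_r_inv r_one)
  then show ?thesis ..
qed

text \<open>From \<open>x I = I\<close> it would follow that \<open>I = x\<^sup>k I\<close> for all \<open>k\<close>, but \<open>x\<close> is nilpotent.\<close>

lemma (in local_artinian_ring) mult_image_ne:
  assumes x: "x \<in> \<mm>" and I: "ideal I R" and "I \<noteq> {\<zero>}"
  shows "(\<lambda>a. x \<otimes> a) ` I \<noteq> I"
proof
  assume eq: "(\<lambda>a. x \<otimes> a) ` I = I"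
  interpret I: ideal I R by (rule I)
  have xR: "x \<in> carrier R" using x maximal_subset_carrier by blast
  have div: "\<exists>b\<in>I. a = x [^] k \<otimes> b" if "a \<in> I" for a and k :: nat
    using that
  proof (induction k arbitrary: a)
    case 0
    then show ?case using I.Icarr by auto
  next
    case (Suc k)
    then obtain b where b: "b \<in> I" "a = x [^] k \<otimes> b" by blast
    then obtain c where c: "c \<in> I" "b = x \<otimes> c" using eq by blast
    have "a = x [^] Suc k \<otimes> c" using b c xR I.Icarr by (simp add: m_assoc)
    then show ?case using c by blast
  qed
  obtain k :: nat where k: "x [^] k = \<zero>" using nilpotent_if_in_maximal[OF x] ..
  have "a = \<zero>" if "a \<in> I" for a
    using div[OF that, of k] I.Icarr unfolding k by auto
  then have "I \<subseteq> {\<zero>}" by blast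
  then show False using \<open>I \<noteq> {\<zero>}\<close> I.zero_closed by blast
qed

text \<open>If \<open>\<mm>\<close> annihilates \<open>M\<close>, then \<open>M\<close> is a vector space over the residue field, and a submodule that is maximal
  among those avoiding \<open>v\<close> is a hyperplane: together with any vector \<open>a\<close> outside of it, it spans \<open>M\<close>.
  Indeed \<open>N + R w\<close> contains \<open>v\<close> for each \<open>w\<close> outside \<open>N\<close>, and the coefficient of \<open>w\<close> is a unit.
  Comparing the expressions of \<open>v\<close> by \<open>a\<close> and by \<open>b\<close> yields \<open>b\<close>.\<close>

lemma (in local_cring) hyperplane_if_maximal_avoiding:
  assumes M: "module R M"
    and killed: "\<And>a w. a \<in> \<mm> \<Longrightarrow> w \<in> carrier M \<Longrightarrow> a \<odot>\<^bsub>M\<^esub> w = \<zero>\<^bsub>M\<^esub>"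
    and N: "submodule R N M" and v: "v \<notin> N"
    and max: "\<And>L. submodule R L M \<Longrightarrow> N \<subseteq> L \<Longrightarrow> v \<notin> L \<Longrightarrow> L = N"
    and a: "a \<in> carrier M" "a \<notin> N" and b: "b \<in> carrier M"
  shows "\<exists>n\<in>N. \<exists>t\<in>carrier R. b = n \<oplus>\<^bsub>M\<^esub> t \<odot>\<^bsub>M\<^esub> a"
proof -
  interpret M: module R M by (rule M)
  interpret N: submodule R N M by (rule N)
  have NM: "n \<in> carrier M" if "n \<in> N" for n using that N.subset by blast
  have reach: "\<exists>n\<in>N. \<exists>s\<in>Units R. v = n \<oplus>\<^bsub>M\<^esub> s \<odot>\<^bsub>M\<^esub> w" if w: "w \<in> carrier M" "w \<notin> N" for w
  proof -
    let ?L = "{n \<oplus>\<^bsub>M\<^esub> s \<odot>\<^bsub>M\<^esub> w | n s. n \<in> N \<and> s \<in> carrier R}"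
    have L: "submodule R ?L M"
    proof (intro submodule.intro M)
      show "?L \<subseteq> carrier M" using NM w by auto
      show "x \<oplus>\<^bsub>M\<^esub> y \<in> ?L" if "x \<in> ?L" "y \<in> ?L" for x y
      proof -
        from \<open>x \<in> ?L\<close> obtain n s where x: "n \<in> N" "s \<in> carrier R" "x = n \<oplus>\<^bsub>M\<^esub> s \<odot>\<^bsub>M\<^esub> w" by auto
        from \<open>y \<in> ?L\<close> obtain n' s' where y: "n' \<in> N" "s' \<in> carrier R" "y = n' \<oplus>\<^bsub>M\<^esub> s' \<odot>\<^bsub>M\<^esub> w" by auto
        note xy = x y
        have "x \<oplus>\<^bsub>M\<^esub> y = (n \<oplus>\<^bsub>M\<^esub> n') \<oplus>\<^bsub>M\<^esub> (s \<oplus> s') \<odot>\<^bsub>M\<^esub> w"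
          using xy w NM by (simp add: M.smult_l_distr M.M.a_ac)
        moreover have "n \<oplus>\<^bsub>M\<^esub> n' \<in> N" "s \<oplus> s' \<in> carrier R" using xy by simp_all
        ultimately show ?thesis by (intro CollectI exI conjI)
      qed
      have "\<zero>\<^bsub>M\<^esub> = \<zero>\<^bsub>M\<^esub> \<oplus>\<^bsub>M\<^esub> \<zero> \<odot>\<^bsub>M\<^esub> w" using w by simp
      then show "\<zero>\<^bsub>M\<^esub> \<in> ?L" using N.zero_closed by blast
      show "c \<odot>\<^bsub>M\<^esub> x \<in> ?L" if "c \<in> carrier R" "x \<in> ?L" for c x
      proof -
        from \<open>x \<in> ?L\<close> obtain n s where x: "n \<in> N" "s \<in> carrier R" "x = n \<oplus>\<^bsub>M\<^esub> s \<odot>\<^bsub>M\<^esub> w" by auto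
        have "c \<odot>\<^bsub>M\<^esub> x = c \<odot>\<^bsub>M\<^esub> n \<oplus>\<^bsub>M\<^esub> (c \<otimes> s) \<odot>\<^bsub>M\<^esub> w"
          using x that w NM by (simp add: M.smult_r_distr M.smult_assoc1)
        moreover have "c \<odot>\<^bsub>M\<^esub> n \<in> N" "c \<otimes> s \<in> carrier R" using x that by simp_all
        ultimately show ?thesis by (intro CollectI exI conjI)
      qed
    qed
    have NL: "N \<subseteq> ?L"
    proof
      fix n assume n: "n \<in> N"
      then have "n = n \<oplus>\<^bsub>M\<^esub> \<zero> \<odot>\<^bsub>M\<^esub> w" using w NM by simp
      then show "n \<in> ?L" using n by blast
    qed
    have wL: "w \<in> ?L"
    proof -
      have "w = \<zero>\<^bsub>M\<^esub> \<oplus>\<^bsub>M\<^esub> \<one> \<odot>\<^bsub>M\<^esub> w" using w by simp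
      then show ?thesis using N.zero_closed by blast
    qed
    have "v \<in> ?L"
    proof (rule ccontr)
      assume "v \<notin> ?L"
      then have "?L = N" by (rule max[OF L NL])
      then have "w \<in> N" using wL by (rule equalityD1[THEN subsetD])
      with w(2) show False by (rule notE)
    qed
    then obtain n s where ns: "n \<in> N" "s \<in> carrier R" "v = n \<oplus>\<^bsub>M\<^esub> s \<odot>\<^bsub>M\<^esub> w" by blast
    have "s \<notin> \<mm>"
    proof
      assume "s \<in> \<mm>"
      then have "v = n" using ns w(1) killed NM by simp
      then show False using ns(1) v by simp
    qed
    then have "s \<in> Units R" by (rule unit_if_notin_maximal[OF ns(2)])
    then show ?thesis using ns(1,3) by (intro bexI)
  qed
  show ?thesis
  proof (cases "b \<in> N")
    case True
    have "b = b \<oplus>\<^bsub>M\<^esub> \<zero> \<odot>\<^bsub>M\<^esub> a" using a b by simp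
    then show ?thesis using True by blast
  next
    case False
    obtain n s where n: "n \<in> N" "s \<in> Units R" "v = n \<oplus>\<^bsub>M\<^esub> s \<odot>\<^bsub>M\<^esub> b" using reach[OF b False] by blast
    obtain n' s' where n': "n' \<in> N" "s' \<in> Units R" "v = n' \<oplus>\<^bsub>M\<^esub> s' \<odot>\<^bsub>M\<^esub> a" using reach[OF a] by blast
    have s: "s \<in> carrier R" "s' \<in> carrier R" "inv s \<in> carrier R" using n n' by auto
    have "s \<odot>\<^bsub>M\<^esub> b = (n' \<oplus>\<^bsub>M\<^esub> s' \<odot>\<^bsub>M\<^esub> a) \<ominus>\<^bsub>M\<^esub> n"
    proof -
      have "n \<oplus>\<^bsub>M\<^esub> s \<odot>\<^bsub>M\<^esub> b = n' \<oplus>\<^bsub>M\<^esub> s' \<odot>\<^bsub>M\<^esub> a" using n(3) n'(3) by simp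
      moreover have "n \<oplus>\<^bsub>M\<^esub> s \<odot>\<^bsub>M\<^esub> b \<ominus>\<^bsub>M\<^esub> n = s \<odot>\<^bsub>M\<^esub> b"
        using s NM[OF n(1)] b M.M.a_comm[of n "s \<odot>\<^bsub>M\<^esub> b"] by (simp add: a_minus_def M.M.a_assoc M.M.r_neg)
      ultimately show ?thesis by simp
    qed
    also have "\<dots> = (n' \<ominus>\<^bsub>M\<^esub> n) \<oplus>\<^bsub>M\<^esub> s' \<odot>\<^bsub>M\<^esub> a"
      using s NM[OF n(1)] NM[OF n'(1)] a by (simp add: a_minus_def M.M.a_ac)
    finally have sb: "s \<odot>\<^bsub>M\<^esub> b = (n' \<ominus>\<^bsub>M\<^esub> n) \<oplus>\<^bsub>M\<^esub> s' \<odot>\<^bsub>M\<^esub> a" .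
    have d: "n' \<ominus>\<^bsub>M\<^esub> n \<in> N" by (rule M.submodule_minus[OF N n'(1) n(1)])
    have "b = inv s \<odot>\<^bsub>M\<^esub> (s \<odot>\<^bsub>M\<^esub> b)" using s b n(2) by (simp flip: M.smult_assoc1)
    also have "\<dots> = inv s \<odot>\<^bsub>M\<^esub> (n' \<ominus>\<^bsub>M\<^esub> n) \<oplus>\<^bsub>M\<^esub> (inv s \<otimes> s') \<odot>\<^bsub>M\<^esub> a"
      unfolding sb using s NM[OF d] a by (simp add: M.smult_r_distr M.smult_assoc1)
    finally show ?thesis
      using N.smult_closed[OF s(3) d] m_closed[OF s(3) s(2)] by (intro bexI)
  qed
qed

text \<open>A hyperplane has codimension one, so it contributes all of the length except one. As a potential for
  submodules \<open>A\<close>, take the length of \<open>A \<inter> N\<close>, increased by one if \<open>A\<close> is not contained in \<open>N\<close>.\<close>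

lemma (in local_cring) module_length_le_Suc_hyperplane:
  assumes M: "module R M"
    and killed: "\<And>a w. a \<in> \<mm> \<Longrightarrow> w \<in> carrier M \<Longrightarrow> a \<odot>\<^bsub>M\<^esub> w = \<zero>\<^bsub>M\<^esub>"
    and N: "submodule R N M" and v: "v \<notin> N"
    and max: "\<And>L. submodule R L M \<Longrightarrow> N \<subseteq> L \<Longrightarrow> v \<notin> L \<Longrightarrow> L = N"
    and l: "module_length R (M\<lparr>carrier := N\<rparr>) = enat l"
  shows "module_length R M \<le> enat (Suc l)"
proof -
  interpret M: module R M by (rule M)
  let ?l = "\<lambda>A. module_length R (M\<lparr>carrier := A \<inter> N\<rparr>)"
  let ?d = "\<lambda>A. if A \<subseteq> N then 0 else 1 :: nat"
  have le: "?l A \<le> enat l" if "submodule R A M" for A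
    using M.module_length_mono[OF M.submodule_inter[OF that N] N] l by simp
  show ?thesis
  proof (rule module_length_le_potential[where \<phi> = "\<lambda>A. the_enat (?l A) + ?d A"])
    fix A assume A: "submodule R A M"
    obtain p where "?l A = enat p" "p \<le> l" using le[OF A] by (cases "?l A") auto
    then show "the_enat (?l A) + ?d A \<le> Suc l" by simp
  next
    fix A B assume A: "submodule R A M" and B: "submodule R B M" and AB: "A \<subset> B"
    obtain p where p: "?l A = enat p" using le[OF A] by (cases "?l A") auto
    obtain q where q: "?l B = enat q" using le[OF B] by (cases "?l B") auto
    show "the_enat (?l A) + ?d A < the_enat (?l B) + ?d B"
    proof (cases "A \<inter> N = B \<inter> N")
      case False
      then have "A \<inter> N \<subset> B \<inter> N" using AB by blast
      then have "?l A < ?l B"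
        using M.module_length_strict_mono[OF M.submodule_inter[OF A N] M.submodule_inter[OF B N]] q by simp
      moreover have "?d A \<le> ?d B" using AB by auto
      ultimately show ?thesis using p q by simp
    next
      case True
      have "A \<subseteq> N"
      proof (rule ccontr)
        assume "\<not> A \<subseteq> N"
        then obtain a where a: "a \<in> A" "a \<notin> N" by blast
        then have aM: "a \<in> carrier M" using submodule.subset[OF A] by blast
        have "b \<in> A" if b: "b \<in> B" for b
        proof -
          have bM: "b \<in> carrier M" using b submodule.subset[OF B] by blast
          obtain n t where nt: "n \<in> N" "t \<in> carrier R" "b = n \<oplus>\<^bsub>M\<^esub> t \<odot>\<^bsub>M\<^esub> a"
            using hyperplane_if_maximal_avoiding[OF M killed N v max aM a(2) bM] by blast
          have nM: "n \<in> carrier M" using nt submodule.subset[OF N] by blast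
          have ta: "t \<odot>\<^bsub>M\<^esub> a \<in> A" using submodule.smult_closed[OF A] nt a by blast
          have "b \<ominus>\<^bsub>M\<^esub> t \<odot>\<^bsub>M\<^esub> a \<in> B" using M.submodule_minus[OF B b] ta AB by blast
          moreover have "b \<ominus>\<^bsub>M\<^esub> t \<odot>\<^bsub>M\<^esub> a = n"
            using nt nM aM by (simp add: a_minus_def M.M.a_assoc M.M.r_neg)
          ultimately have "n \<in> A" using True nt by blast
          then show "b \<in> A" using submodule.m_closed[OF A _ ta] nt(3) by blast
        qed
        then show False using AB by blast
      qed
      moreover have "\<not> B \<subseteq> N" using True AB \<open>A \<subseteq> N\<close> by blast
      ultimately show ?thesis using True by simp
    qed
  qed
qed

lemma (in cring) mult_mod_hom:
  assumes I: "ideal I R" and x: "x \<in> carrier R"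
  shows "mod_hom R ((self_module R)\<lparr>carrier := I\<rparr>) (self_module R) (\<lambda>a. x \<otimes> a)"
proof -
  interpret self: module R "self_module R" by (rule self_module_is_module)
  have "mod_hom R (self_module R) (self_module R) (\<lambda>a. x \<otimes> a)"
    by (rule mod_homI) (use x self.module_axioms in \<open>auto simp: r_distr m_lcomm\<close>)
  then show ?thesis using mod_hom.restrict_submodule I ideal_iff_submodule by blast
qed

text \<open>Otherwise there is an ideal \<open>I\<close> that is minimal among those of infinite length. For \<open>x \<in> \<mm>\<close> the ideal \<open>x I\<close>
  is proper in \<open>I\<close>, hence of finite length; by additivity the annihilator of \<open>x\<close> in \<open>I\<close> has infinite length,
  so it is all of \<open>I\<close>. Hence \<open>\<mm> I = 0\<close>. But then \<open>I\<close> has a submodule of codimension one, which has finite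
  length by the choice of \<open>I\<close>, and so has \<open>I\<close>: a contradiction.\<close>

theorem (in local_artinian_ring) finite_module_length: "module_length R (self_module R) \<noteq> \<infinity>"
proof
  interpret self: module R "self_module R" by (rule self_module_is_module)
  let ?l = "\<lambda>I. module_length R ((self_module R)\<lparr>carrier := I\<rparr>)"
  assume top: "module_length R (self_module R) = \<infinity>"
  have self: "(self_module R)\<lparr>carrier := carrier R\<rparr> = self_module R" by (simp add: self_module_def)
  have "?l (carrier R) = \<infinity>" unfolding self by (rule top)
  from minimal_ideal_exists[where P = "\<lambda>I. ?l I = \<infinity>", OF oneideal this]
  obtain I where "ideal I R \<and> ?l I = \<infinity> \<and> (\<forall>L. ideal L R \<longrightarrow> L \<subset> I \<longrightarrow> ?l L \<noteq> \<infinity>)" ..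
  then have I: "ideal I R" and inf: "?l I = \<infinity>"
    and min: "\<And>L. ideal L R \<Longrightarrow> L \<subset> I \<Longrightarrow> ?l L \<noteq> \<infinity>" by simp_all
  interpret I: ideal I R by (rule I)
  have I_sub: "submodule R I (self_module R)" using I by (simp add: ideal_iff_submodule)
  let ?I = "(self_module R)\<lparr>carrier := I\<rparr>"
  interpret IM: module R ?I by (rule self.submodule_is_module[OF I_sub])
  have "I \<noteq> {\<zero>}" using inf self.module_length_zero by auto
  have killed: "x \<otimes> a = \<zero>" if x: "x \<in> \<mm>" and a: "a \<in> I" for x a
  proof -
    have xR: "x \<in> carrier R" using x maximal_subset_carrier by blast
    interpret f: mod_hom R ?I "self_module R" "\<lambda>a. x \<otimes> a" by (rule mult_mod_hom[OF I xR])
    have ker_sub: "submodule R f.ker (self_module R)" "f.ker \<subseteq> I"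
      using f.ker_is_submodule self.submodule_in_submodule_iff[OF I_sub] by auto
    have "f.im \<subset> I" using mult_image_ne[OF x I \<open>I \<noteq> {\<zero>}\<close>] I.I_l_closed xR by (auto simp: f.im_def)
    then have "?l f.im \<noteq> \<infinity>" using min f.im_is_submodule ideal_iff_submodule by blast
    then have "?l f.ker = \<infinity>" using f.module_length_ker_im inf by (cases "?l f.ker") auto
    then have "f.ker = I" using min[of f.ker] ker_sub ideal_iff_submodule by blast
    then show ?thesis using a by (auto simp: f.ker_def)
  qed
  \<comment> \<open>A submodule of \<open>I\<close> that is maximal among those avoiding a nonzero \<open>v\<close> is a hyperplane in \<open>I\<close>.\<close>
  obtain v where v: "v \<in> I" "v \<noteq> \<zero>" using \<open>I \<noteq> {\<zero>}\<close> I.zero_closed by blast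
  then have "v \<notin> {\<zero>\<^bsub>?I\<^esub>}" by simp
  from IM.maximal_submodule_avoiding[OF IM.zero_submodule this]
  obtain N where N: "submodule R N ?I" "v \<notin> N"
    and max: "\<And>L. submodule R L ?I \<Longrightarrow> N \<subseteq> L \<Longrightarrow> v \<notin> L \<Longrightarrow> L = N" by metis
  have "submodule R N (self_module R)" "N \<subset> I"
    using N v self.submodule_in_submodule_iff[OF I_sub] by auto
  then have "?l N \<noteq> \<infinity>" using min ideal_iff_submodule by blast
  then obtain l where "module_length R (?I\<lparr>carrier := N\<rparr>) = enat l" by auto
  then have "module_length R ?I \<le> enat (Suc l)"
    using module_length_le_Suc_hyperplane[OF IM.module_axioms _ N max] killed by simp
  then show False using inf by simp
qed

text \<open>Let \<open>I\<close> be a minimal nonzero ideal. For \<open>x \<in> \<mm>\<close> the ideal \<open>x I\<close> is strictly smaller than \<open>I\<close>, hence zero;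
  so \<open>I\<close> is contained in the socle.\<close>

theorem (in local_artinian_ring) socle_nonzero: "socle R \<mm> (self_module R) \<noteq> {\<zero>}"
proof -
  have "carrier R \<noteq> {\<zero>}" using one_not_zero one_closed by blast
  from minimal_ideal_exists[where P = "\<lambda>I. I \<noteq> {\<zero>}", OF oneideal this]
  obtain I where "ideal I R \<and> I \<noteq> {\<zero>} \<and> (\<forall>L. ideal L R \<longrightarrow> L \<subset> I \<longrightarrow> \<not> L \<noteq> {\<zero>})" ..
  then have I: "ideal I R" and "I \<noteq> {\<zero>}"
    and min: "\<And>L. ideal L R \<Longrightarrow> L \<subset> I \<Longrightarrow> L = {\<zero>}" by simp_all
  interpret I: ideal I R by (rule I)
  have "x \<otimes> a = \<zero>" if x: "x \<in> \<mm>" and a: "a \<in> I" for x a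
  proof -
    have xR: "x \<in> carrier R" using x maximal_subset_carrier by blast
    interpret f: mod_hom R "(self_module R)\<lparr>carrier := I\<rparr>" "self_module R" "\<lambda>a. x \<otimes> a"
      by (rule mult_mod_hom[OF I xR])
    have "f.im \<subset> I" using mult_image_ne[OF x I \<open>I \<noteq> {\<zero>}\<close>] I.I_l_closed xR by (auto simp: f.im_def)
    then have "f.im = {\<zero>}" using min f.im_is_submodule ideal_iff_submodule by blast
    then show ?thesis using a by (auto simp: f.im_def)
  qed
  then have "I \<subseteq> socle R \<mm> (self_module R)" using I.Icarr by (auto simp: socle_def)
  then show ?thesis using \<open>I \<noteq> {\<zero>}\<close> I.zero_closed by blast
qed

section \<open>Minimum distance and the MDS and MDT conditions\<close>

lemma hamming_weight_le: "hamming_weight R n v \<le> n"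
  unfolding hamming_weight_def using card_mono[of "{..<n}" "{i \<in> {..<n}. v i \<noteq> \<zero>\<^bsub>R\<^esub>}"] by auto

lemma finite_hamming_weights: "finite (hamming_weight R n ` A)"
  by (rule finite_subset[of _ "{..n}"]) (auto simp: hamming_weight_le)

lemma min_distance_le:
  assumes "v \<in> C" "v \<noteq> \<zero>\<^bsub>Rn R n\<^esub>"
  shows "min_distance R n C \<le> hamming_weight R n v"
  unfolding min_distance_def by (rule Min_le[OF finite_hamming_weights]) (use assms in blast)

lemma (in cring) min_distance_bounds:
  assumes C: "is_code R n C" and ne: "C \<noteq> {\<zero>\<^bsub>Rn R n\<^esub>}"
  shows "0 < min_distance R n C" "min_distance R n C \<le> n"
proof -
  have sub: "C \<subseteq> {..<n} \<rightarrow>\<^sub>E carrier R" and zero: "\<zero>\<^bsub>Rn R n\<^esub> \<in> C"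
    using submodule.subset[of R C "Rn R n"] submodule.zero_closed[of R C "Rn R n"] C
    by (simp_all add: is_code_def)
  have "hamming_weight R n ` (C - {\<zero>\<^bsub>Rn R n\<^esub>}) \<noteq> {}" using ne zero by blast
  from Min_in[OF finite_hamming_weights this]
  obtain v where v: "v \<in> C" "v \<noteq> \<zero>\<^bsub>Rn R n\<^esub>" "min_distance R n C = hamming_weight R n v"
    unfolding min_distance_def by blast
  show "min_distance R n C \<le> n" using v(3) hamming_weight_le by metis
  have "\<exists>i<n. v i \<noteq> \<zero>"
  proof (rule ccontr)
    assume "\<not> ?thesis"
    then have "v = (\<lambda>i\<in>{..<n}. \<zero>)" using v(1) sub by (intro PiE_ext[of v "{..<n}" "\<lambda>_. carrier R"]) auto
    with v(2) show False by simp
  qed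
  then show "0 < min_distance R n C"
    unfolding v(3) hamming_weight_def by (auto simp: card_gt_0_iff)
qed

text \<open>A nonzero word that vanishes on the first \<open>k\<close> coordinates would have weight at most \<open>n - k\<close>, which is less
  than the minimum distance.\<close>

lemma (in cring) inj_on_projection:
  assumes C: "is_code R n C" and k: "n < k + min_distance R n C" "k \<le> n"
  shows "inj_on (\<lambda>a. restrict a {..<k}) C"
proof -
  interpret F: module R "Rn R n" by (rule func_space_is_module)
  have C_sub: "submodule R C (Rn R n)" using C by (simp add: is_code_def)
  interpret r: mod_hom R "(Rn R n)\<lparr>carrier := C\<rparr>" "func_space {..<k}" "\<lambda>a. restrict a {..<k}"
    by (rule mod_hom.restrict_submodule[OF restrict_mod_hom C_sub]) (use k in auto)
  have "v = \<zero>\<^bsub>Rn R n\<^esub>" if v: "v \<in> C" and 0: "restrict v {..<k} = (\<lambda>i\<in>{..<k}. \<zero>)" for v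
  proof (rule ccontr)
    assume "v \<noteq> \<zero>\<^bsub>Rn R n\<^esub>"
    then have "min_distance R n C \<le> hamming_weight R n v" by (rule min_distance_le[OF v])
    moreover have "v i = \<zero>" if "i < k" for i using fun_cong[OF 0, of i] that by simp
    then have "{i \<in> {..<n}. v i \<noteq> \<zero>} \<subseteq> {k..<n}" by (auto simp: not_less[symmetric])
    then have "hamming_weight R n v \<le> n - k"
      unfolding hamming_weight_def using card_mono[of "{k..<n}"] by fastforce
    ultimately show False using k by simp
  qed
  then have "r.ker \<subseteq> {\<zero>\<^bsub>Rn R n\<^esub>}" unfolding r.ker_def by auto
  moreover have "\<zero>\<^bsub>Rn R n\<^esub> \<in> r.ker" using submodule.zero_closed[OF r.ker_is_submodule] by simp
  ultimately have "r.ker = {\<zero>\<^bsub>(Rn R n)\<lparr>carrier := C\<rparr>\<^esub>}" by auto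
  then show ?thesis using r.inj_on_iff_ker by simp
qed

text \<open>The two denominators in the definitions of MDS and MDT are finite and positive. The number \<open>s\<close> is the type
  of the ring.\<close>

lemma (in local_artinian_ring) length_and_type_of_ring:
  obtains l s where
    "module_length R (self_module R) = enat l" "0 < l"
    "module_length R ((self_module R)\<lparr>carrier := socle R \<mm> (self_module R)\<rparr>) = enat s" "0 < s"
proof -
  interpret self: module R "self_module R" by (rule self_module_is_module)
  let ?soc = "socle R \<mm> (self_module R)"
  have soc: "submodule R ?soc (self_module R)" by (rule self.socle_submodule[OF maximal_subset_carrier])
  obtain l where l: "module_length R (self_module R) = enat l" using finite_module_length by auto
  have le: "module_length R ((self_module R)\<lparr>carrier := ?soc\<rparr>) \<le> enat l"
    using self.module_length_submodule_mono[OF soc] l by simp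
  then obtain s where s: "module_length R ((self_module R)\<lparr>carrier := ?soc\<rparr>) = enat s"
    by (cases "module_length R ((self_module R)\<lparr>carrier := ?soc\<rparr>)") auto
  have "enat s \<noteq> 0" using self.module_length_pos[OF soc] socle_nonzero s by simp
  then have "0 < s" by (simp add: zero_enat_def)
  moreover have "s \<le> l" using le s by simp
  ultimately show ?thesis using that[OF l _ s] by simp
qed

lemma (in local_artinian_ring) finite_code_length:
  assumes C: "is_code R n C"
  shows "module_length R (code_as_module R n C) \<noteq> \<infinity>"
proof -
  interpret F: module R "Rn R n" by (rule func_space_is_module)
  obtain l where "module_length R (self_module R) = enat l" using finite_module_length by auto
  then have "module_length R (Rn R n) = enat (n * l)"
    by (simp add: module_length_func_space of_nat_eq_enat)
  moreover have "module_length R (code_as_module R n C) \<le> module_length R (Rn R n)"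
    using F.module_length_submodule_mono C by (simp add: is_code_def)
  ultimately obtain c where "module_length R (code_as_module R n C) = enat c" by (metis enat_ile)
  then show ?thesis by simp
qed

lemma (in local_artinian_ring) MDS_iff_MDT_if_free:
  assumes C: "is_code R n C" and free: "free_module R (code_as_module R n C)"
  shows "MDS R n C \<longleftrightarrow> MDT R \<mm> n C"
proof -
  interpret F: module R "Rn R n" by (rule func_space_is_module)
  interpret C: module R "code_as_module R n C"
    by (rule F.submodule_is_module) (use C in \<open>simp add: is_code_def\<close>)
  interpret self: module R "self_module R" by (rule self_module_is_module)
  obtain l s where l: "module_length R (self_module R) = enat l" "0 < l"
    and s: "module_length R ((self_module R)\<lparr>carrier := socle R \<mm> (self_module R)\<rparr>) = enat s" "0 < s"
    by (rule length_and_type_of_ring)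
  have "module_length R (self_module R) \<noteq> 0" using l by (simp add: zero_enat_def)
  from C.free_module_lengths[OF free maximal_subset_carrier this finite_code_length[OF C]]
  obtain k where k: "module_length R (code_as_module R n C) = of_nat k * enat l"
    "module_length R ((code_as_module R n C)\<lparr>carrier := socle R \<mm> (code_as_module R n C)\<rparr>) = of_nat k * enat s"
    unfolding l(1) s(1) by blast
  have "module_type R \<mm> (code_as_module R n C) = k * s"
    by (rule C.module_type_eq_length_socle[OF maximal]) (use k(2) in \<open>simp add: of_nat_eq_enat\<close>)
  moreover have "module_type R \<mm> (self_module R) = s"
    by (rule self.module_type_eq_length_socle[OF maximal s(1)])
  moreover have "the_enat (module_length R (code_as_module R n C)) = k * l"
    using k(1) by (simp add: of_nat_eq_enat)
  ultimately show ?thesis using l s by (simp add: MDS_def MDT_def)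
qed

lemma (in local_artinian_ring) free_if_MDS:
  assumes C: "is_code R n C" and ne: "C \<noteq> {\<zero>\<^bsub>Rn R n\<^esub>}" and MDS: "MDS R n C"
  shows "free_module R (code_as_module R n C)"
proof -
  have C_sub: "submodule R C (Rn R n)" using C by (simp add: is_code_def)
  interpret F: module R "Rn R n" by (rule func_space_is_module)
  obtain l where l: "module_length R (self_module R) = enat l" "0 < l"
    by (rule length_and_type_of_ring)
  obtain c where c: "module_length R (code_as_module R n C) = enat c"
    using finite_code_length[OF C] by auto
  define k where "k = n + 1 - min_distance R n C"
  note d = min_distance_bounds[OF C ne]
  have "real (min_distance R n C) = real n - real c / real l + 1"
    using MDS l(1) c by (simp add: MDS_def)
  then have "real c = (real n + 1 - real (min_distance R n C)) * real l" using l(2) by (simp add: field_simps)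
  also have "real n + 1 - real (min_distance R n C) = real k" using d(2) by (simp add: k_def of_nat_diff)
  finally have ckl: "c = k * l" by (simp flip: of_nat_mult)
  have kn: "k \<le> n" "n < k + min_distance R n C" using d by (simp_all add: k_def)
  interpret r: mod_hom R "code_as_module R n C" "func_space {..<k}" "\<lambda>a. restrict a {..<k}"
    by (rule mod_hom.restrict_submodule[OF restrict_mod_hom C_sub]) (use kn in auto)
  have inj: "inj_on (\<lambda>a. restrict a {..<k}) (carrier (code_as_module R n C))"
    using inj_on_projection[OF C kn(2,1)] by simp
  have "module_length R (func_space {..<k}) = enat c"
    using l(1) by (simp add: module_length_func_space ckl of_nat_eq_enat)
  then have "(\<lambda>a. restrict a {..<k}) ` carrier (code_as_module R n C) = carrier (func_space {..<k})"
    using r.surj_if_inj_length_le[OF inj] c by simp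
  then show ?thesis
    using inj by (intro free_module_if_bij_func_space[OF r.mod_hom_axioms _ one_not_zero])
      (simp_all add: bij_betw_def)
qed

theorem theorem4p8:
  fixes R :: "('a, 'r) ring_scheme" and \<mm> :: "'a set"
    and n :: nat and C :: "(nat \<Rightarrow> 'a) set"
  assumes "local_artinian_ring R \<mm>"
    and "n \<ge> 1"
    and "is_code R n C"
    and "C \<noteq> {\<zero>\<^bsub>Rn R n\<^esub>}"
  shows "MDS R n C \<longleftrightarrow> free_module R (code_as_module R n C) \<and> MDT R \<mm> n C"
proof -
  interpret local_artinian_ring R \<mm> by (rule assms(1))
  show ?thesis
    using free_if_MDS[OF assms(3,4)] MDS_iff_MDT_if_free[OF assms(3)] by blast
qed

end
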